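(* Let $\&$ be a left continuous t-norm on $[0,1]$. Then the following statements are equivalent: (1) The category $[0,1]\text{-}\mathsf{Cat}$ of all $[0,1]$-categories and $[0,1]$-functors (with respect to $\&$) is cartesian closed. (2) The full subcategory $[0,1]\text{-}\mathsf{Cat}_{\mathsf{fin}}$ of $[0,1]\text{-}\mathsf{Cat}$ consisting of the finite $[0,1]$-categories is cartesian closed. (3) Any one of the following three conditions (which are equivalent to one another) holds: (a) for all $p,q,u\in[0,1]$, $(p\& q)\wedge u=((p\wedge u)\& q)\vee(p\&(q\wedge u))$; (b) for all $p,u\in[0,1]$, if $u\le p\& p$ then $u\& p=u$; (c) there is a countable (possibly empty) family $\{[a_i,b_i]\subseteq[0,1)\mid i\in I\}$ of pairwise disjoint closed intervals such that for all $p,q\in[0,1]$, $p\& q=a_i$ if $p,q\in[a_i,b_i]$ for some $i\in I$, and $p\& q=p\wedge q$ otherwise.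
   Context: A left continuous t-norm on $[0,1]$ is a commutative, associative binary operation $\&$ on $[0,1]$ with unit $1$ that preserves arbitrary suprema in each variable. Here $\wedge$ and $\vee$ denote minimum and maximum. Fix $\&$. A $[0,1]$-category $(X,r)$ is a set $X$ with a map $r:X\times X\to[0,1]$ such that $r(x,x)=1$ and $r(y,z)\& r(x,y)\le r(x,z)$ for all $x,y,z\in X$. A $[0,1]$-functor $f:(X,r)\to(Y,s)$ is a map $f:X\to Y$ with $r(x,y)\le s(f(x),f(y))$ for all $x,y\in X$. $[0,1]\text{-}\mathsf{Cat}$ is the category of $[0,1]$-categories and $[0,1]$-functors. A $[0,1]$-category $(X,r)$ is finite if the set $X$ is finite. A category $\mathbf A$ is cartesian closed if it has finite products and for each object $A$ the functor $A\times(-):\mathbf A\to\mathbf A$ has a right adjoint. *)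

theory Defs
  imports Complex_Main "HOL-Library.FuncSet" "HOL-Library.Disjoint_Sets"
begin

section \<open>Left continuous t-norms\<close>

text \<open>The supremum of \<open>S\<close> formed in the complete lattice \<open>[0,1]\<close>. Inserting \<open>0\<close> changes
  nothing for nonempty \<open>S\<close> and makes the supremum of the empty set equal to \<open>0\<close>.\<close>

definition sup01 :: "real set \<Rightarrow> real" where
  "sup01 S = Sup (insert 0 S)"

definition left_continuous_tnorm :: "(real \<Rightarrow> real \<Rightarrow> real) \<Rightarrow> bool" where
  "left_continuous_tnorm T \<longleftrightarrow>
     (\<forall>p\<in>{0..1}. \<forall>q\<in>{0..1}. T p q \<in> {0..1}) \<and>
     (\<forall>p\<in>{0..1}. \<forall>q\<in>{0..1}. T p q = T q p) \<and>
     (\<forall>p\<in>{0..1}. \<forall>q\<in>{0..1}. \<forall>r\<in>{0..1}. T (T p q) r = T p (T q r)) \<and>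
     (\<forall>p\<in>{0..1}. T p 1 = p \<and> T 1 p = p) \<and>
     (\<forall>p\<in>{0..1}. \<forall>S\<subseteq>{0..1}. T p (sup01 S) = sup01 ((\<lambda>s. T p s) ` S)) \<and>
     (\<forall>p\<in>{0..1}. \<forall>S\<subseteq>{0..1}. T (sup01 S) p = sup01 ((\<lambda>s. T s p) ` S))"


section \<open>Categories, functors, adjunctions, cartesian closedness\<close>

text \<open>Morphisms are indexed by source and target: \<open>Hom C X Y\<close> need not be disjoint from other
  hom-sets, and \<open>Cmp C X Y Z g f\<close> is the composite of \<open>f \<in> Hom C X Y\<close> and \<open>g \<in> Hom C Y Z\<close>.
  Only objects in \<open>Obj C\<close> matter.\<close>

record ('o, 'm) cat =
  Obj :: "'o set"
  Hom :: "'o \<Rightarrow> 'o \<Rightarrow> 'm set"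
  Idn :: "'o \<Rightarrow> 'm"
  Cmp :: "'o \<Rightarrow> 'o \<Rightarrow> 'o \<Rightarrow> 'm \<Rightarrow> 'm \<Rightarrow> 'm"

definition category :: "('o, 'm) cat \<Rightarrow> bool" where
  "category C \<longleftrightarrow>
     (\<forall>X\<in>Obj C. Idn C X \<in> Hom C X X) \<and>
     (\<forall>X\<in>Obj C. \<forall>Y\<in>Obj C. \<forall>Z\<in>Obj C. \<forall>f\<in>Hom C X Y. \<forall>g\<in>Hom C Y Z.
        Cmp C X Y Z g f \<in> Hom C X Z) \<and>
     (\<forall>X\<in>Obj C. \<forall>Y\<in>Obj C. \<forall>f\<in>Hom C X Y.
        Cmp C X X Y f (Idn C X) = f \<and> Cmp C X Y Y (Idn C Y) f = f) \<and>
     (\<forall>W\<in>Obj C. \<forall>X\<in>Obj C. \<forall>Y\<in>Obj C. \<forall>Z\<in>Obj C.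
        \<forall>f\<in>Hom C W X. \<forall>g\<in>Hom C X Y. \<forall>h\<in>Hom C Y Z.
          Cmp C W X Z (Cmp C X Y Z h g) f = Cmp C W Y Z h (Cmp C W X Y g f))"

definition full_subcategory :: "('o, 'm) cat \<Rightarrow> ('o \<Rightarrow> bool) \<Rightarrow> ('o, 'm) cat" where
  "full_subcategory C P = C\<lparr>Obj := {X \<in> Obj C. P X}\<rparr>"

text \<open>A functor is given by its action \<open>Fo\<close> on objects and \<open>Fm X Y\<close> on \<open>Hom C X Y\<close>.\<close>

definition is_functor ::
  "('o, 'm) cat \<Rightarrow> ('p, 'n) cat \<Rightarrow> ('o \<Rightarrow> 'p) \<Rightarrow> ('o \<Rightarrow> 'o \<Rightarrow> 'm \<Rightarrow> 'n) \<Rightarrow> bool" where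
  "is_functor C D Fo Fm \<longleftrightarrow>
     (\<forall>X\<in>Obj C. Fo X \<in> Obj D) \<and>
     (\<forall>X\<in>Obj C. \<forall>Y\<in>Obj C. \<forall>f\<in>Hom C X Y. Fm X Y f \<in> Hom D (Fo X) (Fo Y)) \<and>
     (\<forall>X\<in>Obj C. Fm X X (Idn C X) = Idn D (Fo X)) \<and>
     (\<forall>X\<in>Obj C. \<forall>Y\<in>Obj C. \<forall>Z\<in>Obj C. \<forall>f\<in>Hom C X Y. \<forall>g\<in>Hom C Y Z.
        Fm X Z (Cmp C X Y Z g f) = Cmp D (Fo X) (Fo Y) (Fo Z) (Fm Y Z g) (Fm X Y f))"

text \<open>\<open>F : C \<rightarrow> D\<close> is left adjoint to \<open>G : D \<rightarrow> C\<close>: there are bijections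
  \<open>Hom D (F X) Y \<cong> Hom C X (G Y)\<close>, natural in \<open>X\<close> and \<open>Y\<close>.\<close>

definition adjunction ::
  "('o, 'm) cat \<Rightarrow> ('p, 'n) cat \<Rightarrow>
   ('o \<Rightarrow> 'p) \<Rightarrow> ('o \<Rightarrow> 'o \<Rightarrow> 'm \<Rightarrow> 'n) \<Rightarrow>
   ('p \<Rightarrow> 'o) \<Rightarrow> ('p \<Rightarrow> 'p \<Rightarrow> 'n \<Rightarrow> 'm) \<Rightarrow> bool" where
  "adjunction C D Fo Fm Go Gm \<longleftrightarrow>
     is_functor C D Fo Fm \<and> is_functor D C Go Gm \<and>
     (\<exists>\<phi> :: 'o \<Rightarrow> 'p \<Rightarrow> 'n \<Rightarrow> 'm.
        (\<forall>X\<in>Obj C. \<forall>Y\<in>Obj D. bij_betw (\<phi> X Y) (Hom D (Fo X) Y) (Hom C X (Go Y))) \<and>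
        (\<forall>X\<in>Obj C. \<forall>X'\<in>Obj C. \<forall>Y\<in>Obj D. \<forall>Y'\<in>Obj D.
           \<forall>f\<in>Hom C X' X. \<forall>g\<in>Hom D Y Y'. \<forall>h\<in>Hom D (Fo X) Y.
             \<phi> X' Y' (Cmp D (Fo X') Y Y' g (Cmp D (Fo X') (Fo X) Y h (Fm X' X f))) =
             Cmp C X' (Go Y) (Go Y') (Gm Y Y' g) (Cmp C X' X (Go Y) (\<phi> X Y h) f)))"

definition has_right_adjoint ::
  "('o, 'm) cat \<Rightarrow> ('p, 'n) cat \<Rightarrow> ('o \<Rightarrow> 'p) \<Rightarrow> ('o \<Rightarrow> 'o \<Rightarrow> 'm \<Rightarrow> 'n) \<Rightarrow> bool" where
  "has_right_adjoint C D Fo Fm \<longleftrightarrow> (\<exists>Go Gm. adjunction C D Fo Fm Go Gm)"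

text \<open>\<open>P\<close> with the projections \<open>\<pi> i : P \<rightarrow> As ! i\<close> is a product of the finite family of objects
  listed in \<open>As\<close>; the empty list gives terminal objects.\<close>

definition is_product ::
  "('o, 'm) cat \<Rightarrow> 'o list \<Rightarrow> 'o \<Rightarrow> (nat \<Rightarrow> 'm) \<Rightarrow> bool" where
  "is_product C As P \<pi> \<longleftrightarrow>
     P \<in> Obj C \<and>
     (\<forall>i<length As. \<pi> i \<in> Hom C P (As ! i)) \<and>
     (\<forall>Z\<in>Obj C. \<forall>f. (\<forall>i<length As. f i \<in> Hom C Z (As ! i)) \<longrightarrow>
        (\<exists>!h. h \<in> Hom C Z P \<and> (\<forall>i<length As. Cmp C Z P (As ! i) (\<pi> i) h = f i)))"

definition has_finite_products :: "('o, 'm) cat \<Rightarrow> bool" where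
  "has_finite_products C \<longleftrightarrow>
     (\<forall>As. set As \<subseteq> Obj C \<longrightarrow> (\<exists>P \<pi>. is_product C As P \<pi>))"

text \<open>The action on morphisms of \<open>A \<times> (-)\<close>, for the products \<open>P B\<close> of \<open>A\<close> and \<open>B\<close> with projections
  \<open>\<pi> B 0 : P B \<rightarrow> A\<close> and \<open>\<pi> B 1 : P B \<rightarrow> B\<close>: the morphism \<open>A \<times> f\<close> for \<open>f : B \<rightarrow> B'\<close>.\<close>

definition product_map ::
  "('o, 'm) cat \<Rightarrow> 'o \<Rightarrow> ('o \<Rightarrow> 'o) \<Rightarrow> ('o \<Rightarrow> nat \<Rightarrow> 'm) \<Rightarrow> 'o \<Rightarrow> 'o \<Rightarrow> 'm \<Rightarrow> 'm" where
  "product_map C A P \<pi> B B' f =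
     (THE h. h \<in> Hom C (P B) (P B') \<and>
        Cmp C (P B) (P B') A (\<pi> B' 0) h = \<pi> B 0 \<and>
        Cmp C (P B) (P B') B' (\<pi> B' 1) h = Cmp C (P B) B B' f (\<pi> B 1))"

text \<open>The functor \<open>A \<times> (-)\<close> depends on a choice of products, but only up to natural isomorphism,
  so it is immaterial for which choice the right adjoint is required.\<close>

definition cartesian_closed :: "('o, 'm) cat \<Rightarrow> bool" where
  "cartesian_closed C \<longleftrightarrow>
     category C \<and> has_finite_products C \<and>
     (\<forall>A\<in>Obj C. \<exists>P \<pi>.
        (\<forall>B\<in>Obj C. is_product C [A, B] (P B) (\<pi> B)) \<and>
        has_right_adjoint C C P (product_map C A P \<pi>))"


section \<open>Categories enriched in the unit interval\<close>

text \<open>HOL has no type of all sets. The sets underlying the objects are therefore the members of a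
  universe of subsets of a type \<open>'u\<close>, playing the role of a Grothendieck universe. Products and
  power sets are required only up to bijection. The closure properties are those the category of
  sets needs here: closure under small unions and the existence of an infinite member are not
  demanded, so that both Grothendieck universes containing an infinite set and the universe of all
  finite subsets of an infinite type are instances.\<close>

definition universe :: "'u set set \<Rightarrow> bool" where
  "universe U \<longleftrightarrow>
     U \<noteq> {} \<and>
     (\<forall>X\<in>U. \<forall>Y\<subseteq>X. Y \<in> U) \<and>
     (\<forall>X\<in>U. \<forall>f. f ` X \<in> U) \<and>
     (\<forall>X\<in>U. \<forall>Y\<in>U. \<exists>j. inj_on j (X \<times> Y) \<and> j ` (X \<times> Y) \<in> U) \<and>
     (\<forall>X\<in>U. \<exists>j. inj_on j (Pow X) \<and> j ` Pow X \<in> U)"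

type_synonym 'u qcat = "'u set \<times> ('u \<times> 'u \<Rightarrow> real)"

text \<open>Maps are extensional, so that a pair \<open>(X, r)\<close> and a functor \<open>f\<close> carry no information outside
  \<open>X \<times> X\<close> and \<open>X\<close>, and equality is the intended one.\<close>

definition is_qcat :: "(real \<Rightarrow> real \<Rightarrow> real) \<Rightarrow> 'u qcat \<Rightarrow> bool" where
  "is_qcat T A \<longleftrightarrow> (case A of (X, r) \<Rightarrow>
     r \<in> X \<times> X \<rightarrow>\<^sub>E {0..1} \<and>
     (\<forall>x\<in>X. r (x, x) = 1) \<and>
     (\<forall>x\<in>X. \<forall>y\<in>X. \<forall>z\<in>X. T (r (y, z)) (r (x, y)) \<le> r (x, z)))"

definition qfunctors :: "'u qcat \<Rightarrow> 'u qcat \<Rightarrow> ('u \<Rightarrow> 'u) set" where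
  "qfunctors A B = (case A of (X, r) \<Rightarrow> case B of (Y, s) \<Rightarrow>
     {f \<in> X \<rightarrow>\<^sub>E Y. \<forall>x\<in>X. \<forall>y\<in>X. r (x, y) \<le> s (f x, f y)})"

definition QCat :: "(real \<Rightarrow> real \<Rightarrow> real) \<Rightarrow> 'u set set \<Rightarrow> ('u qcat, 'u \<Rightarrow> 'u) cat" where
  "QCat T U =
     \<lparr>Obj = {A. fst A \<in> U \<and> is_qcat T A},
      Hom = qfunctors,
      Idn = (\<lambda>A. restrict id (fst A)),
      Cmp = (\<lambda>A B D g f. compose (fst A) g f)\<rparr>"

definition QCat_fin :: "(real \<Rightarrow> real \<Rightarrow> real) \<Rightarrow> 'u set set \<Rightarrow> ('u qcat, 'u \<Rightarrow> 'u) cat" where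
  "QCat_fin T U = full_subcategory (QCat T U) (\<lambda>A. finite (fst A))"


section \<open>The conditions on the t-norm\<close>

definition cond_a :: "(real \<Rightarrow> real \<Rightarrow> real) \<Rightarrow> bool" where
  "cond_a T \<longleftrightarrow>
     (\<forall>p\<in>{0..1}. \<forall>q\<in>{0..1}. \<forall>u\<in>{0..1}.
        min (T p q) u = max (T (min p u) q) (T p (min q u)))"

definition cond_b :: "(real \<Rightarrow> real \<Rightarrow> real) \<Rightarrow> bool" where
  "cond_b T \<longleftrightarrow> (\<forall>p\<in>{0..1}. \<forall>u\<in>{0..1}. u \<le> T p p \<longrightarrow> T u p = u)"

text \<open>Countable families are indexed by subsets of \<open>nat\<close>.\<close>

definition cond_c :: "(real \<Rightarrow> real \<Rightarrow> real) \<Rightarrow> bool" where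
  "cond_c T \<longleftrightarrow>
     (\<exists>(I :: nat set) a b.
        (\<forall>i\<in>I. 0 \<le> a i \<and> a i \<le> b i \<and> b i < 1) \<and>
        disjoint_family_on (\<lambda>i. {a i..b i}) I \<and>
        (\<forall>p\<in>{0..1}. \<forall>q\<in>{0..1}.
           (\<forall>i\<in>I. p \<in> {a i..b i} \<and> q \<in> {a i..b i} \<longrightarrow> T p q = a i) \<and>
           (\<not> (\<exists>i\<in>I. p \<in> {a i..b i} \<and> q \<in> {a i..b i}) \<longrightarrow> T p q = min p q)))"

end

theory Submission
  imports Defs "HOL-Library.Countable"
begin

text \<open>
  Since the finite members of a universe form a universe again, it suffices to show that the
  category over an arbitrary universe is cartesian closed iff (a) holds. Cartesian closedness means
  that, for all \<open>A\<close> and \<open>Y\<close>, every \<open>h : A \<times> Z \<rightarrow> Y\<close> factors uniquely through an evaluation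
  \<open>A \<times> G \<rightarrow> Y\<close>. Given (a), \<open>G\<close> consists of the functors \<open>A \<rightarrow> Y\<close> with the largest hom making
  evaluation a functor, and (a) is what its transitivity requires. Conversely, let \<open>A\<close> be a chain of
  two points with hom \<open>u\<close>. Gluing chains of two points with homs \<open>p\<close> and \<open>q\<close> at a common point
  gives a chain of three points with hom \<open>p & q\<close> between its ends; as \<open>A \<times> (-)\<close> has to preserve this
  gluing, the hom \<open>(p & q) \<and> u\<close> from corner to corner of the product is at most the value generated
  by the two halves, which is the right hand side of (a). For (c), the intervals are the
  nondegenerate fibres of \<open>p \<mapsto> p & p\<close>; they are closed by left continuity.
\<close>

section \<open>Right adjoints and universal arrows\<close>

text \<open>Two things are never given concretely: the universe offers products, power sets and
  function sets only up to bijection, and a categorical product is known only by its universal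
  property. So each construction is made on a convenient index set (lists, functors, pairs of
  numbers) and carried into \<open>'u\<close> along an injection, while chosen products are shown to
  have the minimum as hom and are then traded for curried maps. Preservation of the gluing is not
  argued with colimits. The product with the lowered corner is itself taken as the target
  \<open>Y\<close>: it is transitive for every left continuous t-norm, and each half of the product
  maps into it identically, because the lowered pair lies in neither half. The transposes of the
  halves agree at the common point by uniqueness, so transitivity inside the exponential gives a hom
  of at least p & q, and evaluation brings it back to the lowered corner. Only one inequality of (a)
  is ever at stake; the other holds for every left continuous t-norm. For (c), note that (b) makes
  each p & p idempotent, so a nonempty fibre of p \<mapsto> p & p begins at its own value.\<close>

lemma categoryD:
  assumes "category C"
  shows "X \<in> Obj C \<Longrightarrow> Idn C X \<in> Hom C X X"
    and "\<lbrakk>X \<in> Obj C; Y \<in> Obj C; Z \<in> Obj C; f \<in> Hom C X Y; g \<in> Hom C Y Z\<rbrakk>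
      \<Longrightarrow> Cmp C X Y Z g f \<in> Hom C X Z"
    and "\<lbrakk>X \<in> Obj C; Y \<in> Obj C; f \<in> Hom C X Y\<rbrakk> \<Longrightarrow> Cmp C X X Y f (Idn C X) = f"
    and "\<lbrakk>X \<in> Obj C; Y \<in> Obj C; f \<in> Hom C X Y\<rbrakk> \<Longrightarrow> Cmp C X Y Y (Idn C Y) f = f"
    and "\<lbrakk>W \<in> Obj C; X \<in> Obj C; Y \<in> Obj C; Z \<in> Obj C;
        f \<in> Hom C W X; g \<in> Hom C X Y; h \<in> Hom C Y Z\<rbrakk>
      \<Longrightarrow> Cmp C W X Z (Cmp C X Y Z h g) f = Cmp C W Y Z h (Cmp C W X Y g f)"
  using assms unfolding category_def by blast+

lemma is_functorD:
  assumes "is_functor C D Fo Fm"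
  shows "X \<in> Obj C \<Longrightarrow> Fo X \<in> Obj D"
    and "\<lbrakk>X \<in> Obj C; Y \<in> Obj C; f \<in> Hom C X Y\<rbrakk> \<Longrightarrow> Fm X Y f \<in> Hom D (Fo X) (Fo Y)"
    and "X \<in> Obj C \<Longrightarrow> Fm X X (Idn C X) = Idn D (Fo X)"
    and "\<lbrakk>X \<in> Obj C; Y \<in> Obj C; Z \<in> Obj C; f \<in> Hom C X Y; g \<in> Hom C Y Z\<rbrakk>
      \<Longrightarrow> Fm X Z (Cmp C X Y Z g f) = Cmp D (Fo X) (Fo Y) (Fo Z) (Fm Y Z g) (Fm X Y f)"
  using assms unfolding is_functor_def by blast+

definition universal_arrow ::
  "('o, 'm) cat \<Rightarrow> ('p, 'n) cat \<Rightarrow> ('o \<Rightarrow> 'p) \<Rightarrow> ('o \<Rightarrow> 'o \<Rightarrow> 'm \<Rightarrow> 'n) \<Rightarrow> 'p \<Rightarrow> 'o \<Rightarrow> 'n \<Rightarrow> bool" where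
  "universal_arrow C D Fo Fm Y G e \<longleftrightarrow>
     G \<in> Obj C \<and> e \<in> Hom D (Fo G) Y \<and>
     (\<forall>X\<in>Obj C. \<forall>h\<in>Hom D (Fo X) Y.
        \<exists>!k. k \<in> Hom C X G \<and> Cmp D (Fo X) (Fo G) Y e (Fm X G k) = h)"

text \<open>Allows the right adjoint to be tested at one \<open>Y\<close> at a time. From left to
  right \<open>e\<close> is the counit, the map that transposes to the identity; from right to left
  uniqueness of transposes determines \<open>Gm\<close> and forces functoriality and
  naturality.\<close>

lemma has_right_adjoint_iff_universal_arrows:
  assumes C: "category C" and D: "category D" and F: "is_functor C D Fo Fm"
  shows "has_right_adjoint C D Fo Fm \<longleftrightarrow>
    (\<forall>Y\<in>Obj D. \<exists>G e. universal_arrow C D Fo Fm Y G e)"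
proof
  assume "has_right_adjoint C D Fo Fm"
  then obtain Go Gm where adj: "adjunction C D Fo Fm Go Gm"
    unfolding has_right_adjoint_def by blast
  have G: "is_functor D C Go Gm"
    using adj unfolding adjunction_def by blast
  obtain \<phi> where
    bij: "\<And>X Y. X \<in> Obj C \<Longrightarrow> Y \<in> Obj D \<Longrightarrow> bij_betw (\<phi> X Y) (Hom D (Fo X) Y) (Hom C X (Go Y))"
    and nat: "\<And>X X' Y Y' f g h. \<lbrakk>X \<in> Obj C; X' \<in> Obj C; Y \<in> Obj D; Y' \<in> Obj D;
      f \<in> Hom C X' X; g \<in> Hom D Y Y'; h \<in> Hom D (Fo X) Y\<rbrakk> \<Longrightarrow>
      \<phi> X' Y' (Cmp D (Fo X') Y Y' g (Cmp D (Fo X') (Fo X) Y h (Fm X' X f))) =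
      Cmp C X' (Go Y) (Go Y') (Gm Y Y' g) (Cmp C X' X (Go Y) (\<phi> X Y h) f)"
    using adj unfolding adjunction_def by blast
  show "\<forall>Y\<in>Obj D. \<exists>G e. universal_arrow C D Fo Fm Y G e"
  proof
    fix Y assume Y: "Y \<in> Obj D"
    have GY: "Go Y \<in> Obj C" using is_functorD(1)[OF G Y] .
    have "Idn C (Go Y) \<in> \<phi> (Go Y) Y ` Hom D (Fo (Go Y)) Y"
      using bij[OF GY Y] categoryD(1)[OF C GY] by (simp add: bij_betw_def)
    then obtain e where e: "e \<in> Hom D (Fo (Go Y)) Y" "\<phi> (Go Y) Y e = Idn C (Go Y)"
      by force
    have "\<exists>!k. k \<in> Hom C X (Go Y) \<and> Cmp D (Fo X) (Fo (Go Y)) Y e (Fm X (Go Y) k) = h"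
      if X: "X \<in> Obj C" and h: "h \<in> Hom D (Fo X) Y" for X h
    proof -
      have FX: "Fo X \<in> Obj D" "Fo (Go Y) \<in> Obj D" using is_functorD(1)[OF F] X GY by auto
      have mem: "Cmp D (Fo X) (Fo (Go Y)) Y e (Fm X (Go Y) k) \<in> Hom D (Fo X) Y"
        if "k \<in> Hom C X (Go Y)" for k
        using categoryD(2)[OF D FX Y is_functorD(2)[OF F X GY that] e(1)] .
      \<comment> \<open>Naturality at the counit \<open>e\<close>, with the identity of
        \<open>Y\<close> as second morphism: transposing \<open>e\<close> after \<open>F k\<close>
        returns \<open>k\<close>. Injectivity of \<open>\<phi>\<close> then gives the other round
        trip.\<close>
      have eq: "\<phi> X Y (Cmp D (Fo X) (Fo (Go Y)) Y e (Fm X (Go Y) k)) = k"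
        if k: "k \<in> Hom C X (Go Y)" for k
        using nat[OF GY X Y Y k categoryD(1)[OF D Y] e(1)] e(2)
          categoryD(4)[OF D FX(1) Y mem[OF k]] categoryD(4)[OF C X GY k] is_functorD(3)[OF G Y]
        by simp
      have "\<phi> X Y h \<in> Hom C X (Go Y)"
        using bij[OF X Y] h by (auto simp: bij_betw_def)
      moreover have "Cmp D (Fo X) (Fo (Go Y)) Y e (Fm X (Go Y) (\<phi> X Y h)) = h"
        using eq[OF calculation] mem[OF calculation] bij[OF X Y] h
        by (auto simp: bij_betw_def dest: inj_onD)
      ultimately show ?thesis using eq by metis
    qed
    then show "\<exists>G e. universal_arrow C D Fo Fm Y G e"
      unfolding universal_arrow_def using GY e(1) by blast
  qed
next
  assume "\<forall>Y\<in>Obj D. \<exists>G e. universal_arrow C D Fo Fm Y G e"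
  then obtain Go e where ua: "\<And>Y. Y \<in> Obj D \<Longrightarrow> universal_arrow C D Fo Fm Y (Go Y) (e Y)"
    by metis
  have GY: "Go Y \<in> Obj C" and eY: "e Y \<in> Hom D (Fo (Go Y)) Y" if "Y \<in> Obj D" for Y
    using ua[OF that] unfolding universal_arrow_def by auto
  define \<phi> where "\<phi> X Y h =
    (THE k. k \<in> Hom C X (Go Y) \<and> Cmp D (Fo X) (Fo (Go Y)) Y (e Y) (Fm X (Go Y) k) = h)" for X Y h
  have ex1: "\<exists>!k. k \<in> Hom C X (Go Y) \<and> Cmp D (Fo X) (Fo (Go Y)) Y (e Y) (Fm X (Go Y) k) = h"
    if "X \<in> Obj C" "Y \<in> Obj D" "h \<in> Hom D (Fo X) Y" for X Y h
    using ua[OF that(2)] that unfolding universal_arrow_def by blast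
  have \<phi>: "\<phi> X Y h \<in> Hom C X (Go Y)"
      "Cmp D (Fo X) (Fo (Go Y)) Y (e Y) (Fm X (Go Y) (\<phi> X Y h)) = h"
    if "X \<in> Obj C" "Y \<in> Obj D" "h \<in> Hom D (Fo X) Y" for X Y h
    using theI'[OF ex1[OF that]] unfolding \<phi>_def by auto
  have \<phi>_eqI: "\<phi> X Y h = k"
    if "X \<in> Obj C" "Y \<in> Obj D" "k \<in> Hom C X (Go Y)"
      "Cmp D (Fo X) (Fo (Go Y)) Y (e Y) (Fm X (Go Y) k) = h" for X Y h k
  proof -
    have "h \<in> Hom D (Fo X) Y"
      using categoryD(2)[OF D _ _ that(2) is_functorD(2)[OF F that(1) GY[OF that(2)] that(3)]
          eY[OF that(2)]] is_functorD(1)[OF F] GY that by auto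
    then show ?thesis
      unfolding \<phi>_def using ex1[OF that(1,2)] that by (intro the1_equality) auto
  qed
  define Gm where "Gm Y Y' g = \<phi> (Go Y) Y' (Cmp D (Fo (Go Y)) Y Y' g (e Y))" for Y Y' g
  note Fob = is_functorD(1)[OF F]
  have gm_mem: "Cmp D (Fo (Go Y)) Y Y' g (e Y) \<in> Hom D (Fo (Go Y)) Y'"
    if "Y \<in> Obj D" "Y' \<in> Obj D" "g \<in> Hom D Y Y'" for Y Y' g
    using categoryD(2)[OF D Fob[OF GY[OF that(1)]] that(1,2) eY[OF that(1)] that(3)] .
  have Gm: "Gm Y Y' g \<in> Hom C (Go Y) (Go Y')"
      "Cmp D (Fo (Go Y)) (Fo (Go Y')) Y' (e Y') (Fm (Go Y) (Go Y') (Gm Y Y' g))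
        = Cmp D (Fo (Go Y)) Y Y' g (e Y)"
    if "Y \<in> Obj D" "Y' \<in> Obj D" "g \<in> Hom D Y Y'" for Y Y' g
    using \<phi>[OF GY[OF that(1)] that(2) gm_mem[OF that]] unfolding Gm_def by auto
  \<comment> \<open>Naturality of the counit, precomposed with \<open>F k\<close>. The composition
    law of \<open>Gm\<close> and the naturality of \<open>\<phi>\<close> both reduce to it by
    uniqueness.\<close>
  have comp: "Cmp D (Fo X) (Fo (Go Y')) Y' (e Y')
        (Fm X (Go Y') (Cmp C X (Go Y) (Go Y') (Gm Y Y' g) k))
      = Cmp D (Fo X) Y Y' g (Cmp D (Fo X) (Fo (Go Y)) Y (e Y) (Fm X (Go Y) k))"
    if X: "X \<in> Obj C" and Y: "Y \<in> Obj D" "Y' \<in> Obj D" and g: "g \<in> Hom D Y Y'"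
      and k: "k \<in> Hom C X (Go Y)" for X Y Y' g k
  proof -
    note k' = is_functorD(2)[OF F X GY[OF Y(1)] k]
    note g' = is_functorD(2)[OF F GY[OF Y(1)] GY[OF Y(2)] Gm(1)[OF Y g]]
    show ?thesis
      unfolding is_functorD(4)[OF F X GY[OF Y(1)] GY[OF Y(2)] k Gm(1)[OF Y g]]
        categoryD(5)[OF D Fob[OF X] Fob[OF GY[OF Y(1)]] Fob[OF GY[OF Y(2)]] Y(2)
          k' g' eY[OF Y(2)], symmetric] Gm(2)[OF Y g]
      by (rule categoryD(5)[OF D Fob[OF X] Fob[OF GY[OF Y(1)]] Y k' eY[OF Y(1)] g])
  qed
  have Gfun: "is_functor D C Go Gm"
    unfolding is_functor_def
  proof (intro conjI ballI)
    fix Y assume Y: "Y \<in> Obj D"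
    then show "Go Y \<in> Obj C" by (rule GY)
    show "Gm Y Y (Idn D Y) = Idn C (Go Y)"
      unfolding Gm_def
    proof (rule \<phi>_eqI[OF GY[OF Y] Y categoryD(1)[OF C GY[OF Y]]])
      show "Cmp D (Fo (Go Y)) (Fo (Go Y)) Y (e Y) (Fm (Go Y) (Go Y) (Idn C (Go Y)))
        = Cmp D (Fo (Go Y)) Y Y (Idn D Y) (e Y)"
        unfolding is_functorD(3)[OF F GY[OF Y]] categoryD(3)[OF D Fob[OF GY[OF Y]] Y eY[OF Y]]
          categoryD(4)[OF D Fob[OF GY[OF Y]] Y eY[OF Y]] ..
    qed
    fix Y' assume Y': "Y' \<in> Obj D"
    fix g assume g: "g \<in> Hom D Y Y'"
    show "Gm Y Y' g \<in> Hom C (Go Y) (Go Y')" using Gm(1)[OF Y Y' g] .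
  next
    fix Y Y' Y'' g g'
    assume Y: "Y \<in> Obj D" and Y': "Y' \<in> Obj D" and Y'': "Y'' \<in> Obj D"
      and g: "g \<in> Hom D Y Y'" and g': "g' \<in> Hom D Y' Y''"
    show "Gm Y Y'' (Cmp D Y Y' Y'' g' g) = Cmp C (Go Y) (Go Y') (Go Y'') (Gm Y' Y'' g') (Gm Y Y' g)"
      unfolding Gm_def[of Y Y'' "Cmp D Y Y' Y'' g' g"]
    proof (rule \<phi>_eqI)
      show "Cmp C (Go Y) (Go Y') (Go Y'') (Gm Y' Y'' g') (Gm Y Y' g) \<in> Hom C (Go Y) (Go Y'')"
        using categoryD(2)[OF C GY[OF Y] GY[OF Y'] GY[OF Y''] Gm(1)[OF Y Y' g] Gm(1)[OF Y' Y'' g']] .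
      show "Cmp D (Fo (Go Y)) (Fo (Go Y'')) Y'' (e Y'') (Fm (Go Y) (Go Y'')
          (Cmp C (Go Y) (Go Y') (Go Y'') (Gm Y' Y'' g') (Gm Y Y' g)))
        = Cmp D (Fo (Go Y)) Y Y'' (Cmp D Y Y' Y'' g' g) (e Y)"
        unfolding comp[OF GY[OF Y] Y' Y'' g' Gm(1)[OF Y Y' g]] Gm(2)[OF Y Y' g]
        by (rule categoryD(5)[OF D Fob[OF GY[OF Y]] Y Y' Y'' eY[OF Y] g g', symmetric])
    qed (use GY Y Y'' in auto)
  qed
  have bij: "bij_betw (\<phi> X Y) (Hom D (Fo X) Y) (Hom C X (Go Y))"
    if X: "X \<in> Obj C" and Y: "Y \<in> Obj D" for X Y
  proof (rule bij_betw_byWitness[where f' = "\<lambda>k. Cmp D (Fo X) (Fo (Go Y)) Y (e Y) (Fm X (Go Y) k)"])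
    show "(\<lambda>k. Cmp D (Fo X) (Fo (Go Y)) Y (e Y) (Fm X (Go Y) k)) ` Hom C X (Go Y) \<subseteq> Hom D (Fo X) Y"
      using categoryD(2)[OF D Fob[OF X] Fob[OF GY[OF Y]] Y _ eY[OF Y]]
        is_functorD(2)[OF F X GY[OF Y]] by blast
  qed (use \<phi>[OF X Y] \<phi>_eqI[OF X Y] in auto)
  have nat: "\<phi> X' Y' (Cmp D (Fo X') Y Y' g (Cmp D (Fo X') (Fo X) Y h (Fm X' X f))) =
      Cmp C X' (Go Y) (Go Y') (Gm Y Y' g) (Cmp C X' X (Go Y) (\<phi> X Y h) f)"
    if X: "X \<in> Obj C" and X': "X' \<in> Obj C" and Y: "Y \<in> Obj D" and Y': "Y' \<in> Obj D"
      and f: "f \<in> Hom C X' X" and g: "g \<in> Hom D Y Y'" and h: "h \<in> Hom D (Fo X) Y"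
    for X X' Y Y' f g h
  proof (rule \<phi>_eqI[OF X' Y'])
    note k = \<phi>[OF X Y h]
    note kf = categoryD(2)[OF C X' X GY[OF Y] f k(1)]
    show "Cmp C X' (Go Y) (Go Y') (Gm Y Y' g) (Cmp C X' X (Go Y) (\<phi> X Y h) f) \<in> Hom C X' (Go Y')"
      using categoryD(2)[OF C X' GY[OF Y] GY[OF Y'] kf Gm(1)[OF Y Y' g]] .
    have "Cmp D (Fo X') (Fo (Go Y)) Y (e Y) (Fm X' (Go Y) (Cmp C X' X (Go Y) (\<phi> X Y h) f))
      = Cmp D (Fo X') (Fo X) Y h (Fm X' X f)"
      unfolding is_functorD(4)[OF F X' X GY[OF Y] f k(1)]
        categoryD(5)[OF D Fob[OF X'] Fob[OF X] Fob[OF GY[OF Y]] Y is_functorD(2)[OF F X' X f]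
          is_functorD(2)[OF F X GY[OF Y] k(1)] eY[OF Y], symmetric] k(2) ..
    then show "Cmp D (Fo X') (Fo (Go Y')) Y' (e Y') (Fm X' (Go Y')
          (Cmp C X' (Go Y) (Go Y') (Gm Y Y' g) (Cmp C X' X (Go Y) (\<phi> X Y h) f)))
        = Cmp D (Fo X') Y Y' g (Cmp D (Fo X') (Fo X) Y h (Fm X' X f))"
      unfolding comp[OF X' Y Y' g kf] by simp
  qed
  show "has_right_adjoint C D Fo Fm"
    unfolding has_right_adjoint_def adjunction_def
    by (intro exI[of _ Go] exI[of _ Gm] conjI exI[of _ \<phi>] F Gfun ballI bij nat)
qed


section \<open>Universes\<close>

text \<open>Membership in the universe up to bijection. It also applies to sets of lists, functions
  or subsets, which do not consist of elements of \<open>'u\<close>.\<close>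

definition small :: "'u set set \<Rightarrow> 'i set \<Rightarrow> bool" where
  "small U J \<longleftrightarrow> (\<exists>e. inj_on e J \<and> e ` J \<in> U)"

lemma universeD:
  assumes "universe U"
  shows "X \<in> U \<Longrightarrow> Y \<subseteq> X \<Longrightarrow> Y \<in> U" "X \<in> U \<Longrightarrow> f ` X \<in> U" "{} \<in> U"
    "X \<in> U \<Longrightarrow> Y \<in> U \<Longrightarrow> small U (X \<times> Y)" "X \<in> U \<Longrightarrow> small U (Pow X)"
proof -
  have ne: "U \<noteq> {}" and sub: "\<forall>X\<in>U. \<forall>Y\<subseteq>X. Y \<in> U"
    and image: "\<forall>X\<in>U. \<forall>f. f ` X \<in> U"
    and times: "\<forall>X\<in>U. \<forall>Y\<in>U. small U (X \<times> Y)"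
    and power: "\<forall>X\<in>U. small U (Pow X)"
    using assms unfolding universe_def small_def by - (elim conjE, assumption)+
  show "X \<in> U \<Longrightarrow> Y \<subseteq> X \<Longrightarrow> Y \<in> U" using sub by blast
  show "X \<in> U \<Longrightarrow> f ` X \<in> U" using image by (elim ballE allE) auto
  show "{} \<in> U" using ne sub by blast
  show "X \<in> U \<Longrightarrow> Y \<in> U \<Longrightarrow> small U (X \<times> Y)" using times by (elim ballE) auto
  show "X \<in> U \<Longrightarrow> small U (Pow X)" using power by (elim ballE) auto
qed

lemma small_of_mem: "X \<in> U \<Longrightarrow> small U X"
  unfolding small_def by (rule exI[of _ id]) simp

lemma small_of_inj:
  assumes "universe U" "small U K" "inj_on g J" "g ` J \<subseteq> K"
  shows "small U J"
proof -
  obtain e where e: "inj_on e K" "e ` K \<in> U"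
    using assms(2) unfolding small_def by blast
  have "inj_on (e \<circ> g) J"
    using assms(3,4) e(1) by (meson comp_inj_on inj_on_subset)
  moreover have "(e \<circ> g) ` J \<in> U"
    by (rule universeD(1)[OF assms(1) e(2)]) (use assms(4) in auto)
  ultimately show ?thesis unfolding small_def by blast
qed

lemma small_Times:
  assumes U: "universe U" and "small U J" "small U K"
  shows "small U (J \<times> K)"
proof -
  obtain e f where e: "inj_on e J" "e ` J \<in> U" and f: "inj_on f K" "f ` K \<in> U"
    using assms(2,3) unfolding small_def by blast
  show ?thesis
    by (rule small_of_inj[OF U universeD(4)[OF U e(2) f(2)], where g = "map_prod e f"])
      (use e f in \<open>auto simp: map_prod_inj_on\<close>)
qed

lemma small_Pow:
  assumes U: "universe U" and "small U J"
  shows "small U (Pow J)"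
proof -
  obtain e where e: "inj_on e J" "e ` J \<in> U"
    using assms(2) unfolding small_def by blast
  show ?thesis
    by (rule small_of_inj[OF U universeD(5)[OF U e(2)], where g = "image e"])
      (use e(1) in \<open>auto simp: inj_on_image_Pow\<close>)
qed

text \<open>A function is coded by its graph, a subset of the product; extensionality makes the
  coding injective.\<close>

lemma small_PiE:
  assumes U: "universe U" and "X \<in> U" "Y \<in> U"
  shows "small U (X \<rightarrow>\<^sub>E Y)"
proof (rule small_of_inj[OF U small_Pow[OF U universeD(4)[OF U assms(2,3)]],
      where g = "\<lambda>f. (\<lambda>x. (x, f x)) ` X"])
  show "inj_on (\<lambda>f. (\<lambda>x. (x, f x)) ` X) (X \<rightarrow>\<^sub>E Y)"
  proof (rule inj_onI)
    fix f g assume f: "f \<in> X \<rightarrow>\<^sub>E Y" and g: "g \<in> X \<rightarrow>\<^sub>E Y"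
      and eq: "(\<lambda>x. (x, f x)) ` X = (\<lambda>x. (x, g x)) ` X"
    have "f x = g x" if "x \<in> X" for x
    proof -
      have "(x, f x) \<in> (\<lambda>x. (x, g x)) ` X" using eq that by blast
      then show ?thesis by auto
    qed
    then show "f = g" using f g by (intro PiE_ext)
  qed
qed auto

lemma small_lists:
  assumes U: "universe U" and "\<forall>i<n. X i \<in> U"
  shows "small U {xs. length xs = n \<and> (\<forall>i<n. xs ! i \<in> X i)}"
  using assms(2)
proof (induction n arbitrary: X)
  case 0
  show ?case
    by (rule small_of_inj[OF U universeD(5)[OF U universeD(3)[OF U]], where g = "\<lambda>_. {}"])
      (auto intro: inj_onI)
next
  case (Suc n)
  let ?L = "{xs. length xs = n \<and> (\<forall>i<n. xs ! i \<in> X (Suc i))}"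
  have L: "small U ?L"
    using Suc.IH[of "\<lambda>i. X (Suc i)"] Suc.prems by simp
  have X0: "small U (X 0)"
    using Suc.prems[rule_format, of 0] by (simp add: small_of_mem)
  note sm = small_Times[OF U X0 L]
  show ?case
  proof (rule small_of_inj[OF U sm, where g = "\<lambda>xs. (hd xs, tl xs)"])
    show "inj_on (\<lambda>xs. (hd xs, tl xs)) {xs. length xs = Suc n \<and> (\<forall>i<Suc n. xs ! i \<in> X i)}"
    proof (rule inj_onI, rule list.expand)
      fix xs ys :: "'a list"
      assume "xs \<in> {xs. length xs = Suc n \<and> (\<forall>i<Suc n. xs ! i \<in> X i)}"
        "ys \<in> {xs. length xs = Suc n \<and> (\<forall>i<Suc n. xs ! i \<in> X i)}"
      then have "length xs = Suc n" "length ys = Suc n" by blast+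
      then show "(xs = []) = (ys = [])" by auto
    qed auto
    show "(\<lambda>xs. (hd xs, tl xs)) ` {xs. length xs = Suc n \<and> (\<forall>i<Suc n. xs ! i \<in> X i)}
      \<subseteq> X 0 \<times> ?L"
    proof (rule image_subsetI)
      fix xs assume "xs \<in> {xs. length xs = Suc n \<and> (\<forall>i<Suc n. xs ! i \<in> X i)}"
      then have len: "length xs = Suc n" and *: "\<And>i. i < Suc n \<Longrightarrow> xs ! i \<in> X i" by blast+
      obtain y ys where xs: "xs = y # ys" using len by (cases xs) simp_all
      have "y \<in> X 0" using *[of 0] xs by simp
      moreover have "ys ! i \<in> X (Suc i)" if "i < n" for i using *[of "Suc i"] xs that by simp
      ultimately show "(hd xs, tl xs) \<in> X 0 \<times> ?L" using len xs by simp
    qed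
  qed
qed

text \<open>Start from the empty set and repeat: the power set of an n-element member has 2^n >= n +
  1 elements, and a subset of it has the size wanted. Hence every universe contains all finite sets
  and \<open>'u\<close> is infinite, which supplies the finite test objects below.\<close>

lemma universe_card:
  assumes U: "universe U"
  shows "\<exists>X\<in>U. finite X \<and> card X = n"
proof (induction n)
  case 0
  show ?case using universeD(3)[OF U] by force
next
  case (Suc n)
  then obtain X where X: "X \<in> U" "finite X" "card X = n" by blast
  obtain j where j: "inj_on j (Pow X)" "j ` Pow X \<in> U"
    using universeD(5)[OF U X(1)] unfolding small_def by blast
  have "Suc n \<le> card (j ` Pow X)"
    using j(1) X by (simp add: card_image card_Pow Suc_le_eq)
  then obtain Y where "Y \<subseteq> j ` Pow X" "card Y = Suc n"
    by (meson obtain_subset_with_card_n)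
  then show ?case
    using universeD(1)[OF U j(2)] by (metis card.infinite nat.distinct(1))
qed

lemma universe_finite_mem:
  assumes U: "universe U" and "finite Y"
  shows "Y \<in> U"
proof -
  obtain X where X: "X \<in> U" "finite X" "card X = card Y"
    using universe_card[OF U] by blast
  obtain f where "bij_betw f X Y"
    using finite_same_card_bij[OF X(2) assms(2) X(3)] by blast
  then show ?thesis
    using universeD(2)[OF U X(1), of f] by (simp add: bij_betw_def)
qed

lemma universe_infinite:
  fixes U :: "'u set set"
  assumes "universe U"
  shows "infinite (UNIV :: 'u set)"
proof
  assume fin: "finite (UNIV :: 'u set)"
  obtain X where "X \<in> U" "finite X" "card X = Suc (card (UNIV :: 'u set))"
    using universe_card[OF assms] by blast
  then show False
    using card_mono[OF fin, of X] by simp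
qed

lemma universe_finite_members:
  assumes U: "universe U"
  shows "universe {X \<in> U. finite X}"
  unfolding universe_def
proof (intro conjI ballI allI impI)
  show "{X \<in> U. finite X} \<noteq> {}" using universeD(3)[OF U] by blast
next
  fix X Y assume "X \<in> {X \<in> U. finite X}" "Y \<subseteq> X"
  then show "Y \<in> {X \<in> U. finite X}" using universeD(1)[OF U] by (auto intro: finite_subset)
next
  fix X f assume "X \<in> {X \<in> U. finite X}"
  then show "f ` X \<in> {X \<in> U. finite X}" using universeD(2)[OF U] by auto
next
  fix X Y assume "X \<in> {X \<in> U. finite X}" "Y \<in> {X \<in> U. finite X}"
  then show "\<exists>j. inj_on j (X \<times> Y) \<and> j ` (X \<times> Y) \<in> {X \<in> U. finite X}"
    using universeD(4)[OF U, of X Y] by (auto simp: small_def)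
next
  fix X assume "X \<in> {X \<in> U. finite X}"
  then show "\<exists>j. inj_on j (Pow X) \<and> j ` Pow X \<in> {X \<in> U. finite X}"
    using universeD(5)[OF U, of X] by (auto simp: small_def)
qed

lemma QCat_fin_eq: "QCat_fin T U = QCat T {X \<in> U. finite X}"
  unfolding QCat_fin_def QCat_def full_subcategory_def by auto


section \<open>Left continuous t-norms\<close>

locale left_cont_tnorm =
  fixes T :: "real \<Rightarrow> real \<Rightarrow> real"
  assumes tnorm: "left_continuous_tnorm T"
begin

lemma T_mem: "p \<in> {0..1} \<Longrightarrow> q \<in> {0..1} \<Longrightarrow> T p q \<in> {0..1}"
  and T_commute: "p \<in> {0..1} \<Longrightarrow> q \<in> {0..1} \<Longrightarrow> T p q = T q p"
  and T_assoc: "p \<in> {0..1} \<Longrightarrow> q \<in> {0..1} \<Longrightarrow> r \<in> {0..1} \<Longrightarrow> T (T p q) r = T p (T q r)"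
  and T_one_right: "p \<in> {0..1} \<Longrightarrow> T p 1 = p"
  and T_one_left: "p \<in> {0..1} \<Longrightarrow> T 1 p = p"
  and T_Sup: "p \<in> {0..1} \<Longrightarrow> S \<subseteq> {0..1} \<Longrightarrow> T p (sup01 S) = sup01 ((\<lambda>s. T p s) ` S)"
proof -
  have mem: "\<forall>p\<in>{0..1}. \<forall>q\<in>{0..1}. T p q \<in> {0..1}"
    and commute: "\<forall>p\<in>{0..1}. \<forall>q\<in>{0..1}. T p q = T q p"
    and assoc: "\<forall>p\<in>{0..1}. \<forall>q\<in>{0..1}. \<forall>r\<in>{0..1}. T (T p q) r = T p (T q r)"
    and one: "\<forall>p\<in>{0..1}. T p 1 = p \<and> T 1 p = p"
    and Sup: "\<forall>p\<in>{0..1}. \<forall>S\<subseteq>{0..1}. T p (sup01 S) = sup01 ((\<lambda>s. T p s) ` S)"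
    using tnorm unfolding left_continuous_tnorm_def by - (elim conjE, assumption)+
  show "p \<in> {0..1} \<Longrightarrow> q \<in> {0..1} \<Longrightarrow> T p q \<in> {0..1}" by (rule mem[rule_format])
  show "p \<in> {0..1} \<Longrightarrow> q \<in> {0..1} \<Longrightarrow> T p q = T q p" by (rule commute[rule_format])
  show "p \<in> {0..1} \<Longrightarrow> q \<in> {0..1} \<Longrightarrow> r \<in> {0..1} \<Longrightarrow> T (T p q) r = T p (T q r)"
    by (rule assoc[rule_format])
  show "p \<in> {0..1} \<Longrightarrow> T p 1 = p" by (rule one[rule_format, THEN conjunct1])
  show "p \<in> {0..1} \<Longrightarrow> T 1 p = p" by (rule one[rule_format, THEN conjunct2])
  show "p \<in> {0..1} \<Longrightarrow> S \<subseteq> {0..1} \<Longrightarrow> T p (sup01 S) = sup01 ((\<lambda>s. T p s) ` S)"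
    by (rule Sup[rule_format])
qed

text \<open>Monotonicity is not among the axioms; it comes from preservation of the supremum of the
  pair \<open>{q, q'}\<close>.\<close>

lemma T_mono_right:
  assumes "p \<in> {0..1}" "q \<in> {0..1}" "q' \<in> {0..1}" "q \<le> q'"
  shows "T p q \<le> T p q'"
proof -
  have *: "sup01 {a, b} = max a b" if "0 \<le> a" "0 \<le> b" for a b :: real
    using that unfolding sup01_def by (subst cSup_eq_Max) auto
  show ?thesis
    using T_Sup[of p "{q, q'}"] T_mem[of p q] T_mem[of p q'] assms by (simp add: *)
qed

lemma T_mono:
  assumes "p \<in> {0..1}" "p' \<in> {0..1}" "q \<in> {0..1}" "q' \<in> {0..1}" "p \<le> p'" "q \<le> q'"
  shows "T p q \<le> T p' q'"
proof -
  have "T p q \<le> T p q'" using T_mono_right assms by blast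
  also have "\<dots> = T q' p" using T_commute assms by blast
  also have "\<dots> \<le> T q' p'" using T_mono_right assms by blast
  also have "\<dots> = T p' q'" using T_commute assms by blast
  finally show ?thesis .
qed

lemma T_le_left: "p \<in> {0..1} \<Longrightarrow> q \<in> {0..1} \<Longrightarrow> T p q \<le> p"
  using T_mono_right[of p q 1] T_one_right[of p] by simp

lemma T_le_right: "p \<in> {0..1} \<Longrightarrow> q \<in> {0..1} \<Longrightarrow> T p q \<le> q"
  using T_le_left[of q p] T_commute[of p q] by simp

lemma T_zero_right: "p \<in> {0..1} \<Longrightarrow> T p 0 = 0"
  using T_le_right[of p 0] T_mem[of p 0] by simp

lemma T_zero_left: "p \<in> {0..1} \<Longrightarrow> T 0 p = 0"
  using T_le_left[of 0 p] T_mem[of 0 p] by simp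

section \<open>Equivalence of the conditions (a), (b) and (c)\<close>

lemma cond_a_upper:
  assumes "p \<in> {0..1}" "q \<in> {0..1}" "u \<in> {0..1}"
  shows "max (T (min p u) q) (T p (min q u)) \<le> min (T p q) u"
proof -
  have m: "min p u \<in> {0..1}" "min q u \<in> {0..1}" using assms by auto
  have "T (min p u) q \<le> T p q" "T p (min q u) \<le> T p q"
    using assms m by (intro T_mono; simp)+
  moreover have "T (min p u) q \<le> min p u" "T p (min q u) \<le> min q u"
    using T_le_left T_le_right assms m by blast+
  ultimately show ?thesis by simp
qed

text \<open>For (b), put q = p in (a): since u <= p & p <= p, the left side is u and both terms on
  the right are u & p. For the converse, commutativity allows p <= q, and the only case with content
  is u < p.\<close>

lemma cond_a_iff_cond_b: "cond_a T \<longleftrightarrow> cond_b T"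
proof
  assume a: "cond_a T"
  show "cond_b T"
    unfolding cond_b_def
  proof (intro ballI impI)
    fix p u :: real assume pu: "p \<in> {0..1}" "u \<in> {0..1}" "u \<le> T p p"
    have "u \<le> p" using pu T_le_left[of p p] by simp
    moreover have "min (T p p) u = max (T (min p u) p) (T p (min p u))"
      using a pu unfolding cond_a_def by blast
    moreover have "T p u = T u p" using T_commute pu(1,2) by blast
    ultimately show "T u p = u" using pu(3) by simp
  qed
next
  assume b: "cond_b T"
  have le: "min (T p q) u \<le> max (T (min p u) q) (T p (min q u))"
    if "p \<in> {0..1}" "q \<in> {0..1}" "u \<in> {0..1}" "p \<le> q" for p q u
  proof (cases "u < p")
    case False
    then have "min p u = p" by simp
    then show ?thesis by simp
  next
    case True
    have "min p u = u" "min q u = u" using True that(4) by simp_all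
    then have eq: "max (T (min p u) q) (T p (min q u)) = max (T u q) (T p u)" by simp
    show ?thesis
    proof (cases "u \<le> T q q")
      case True
      then have "T u q = u" using b that(2,3) unfolding cond_b_def by blast
      then show ?thesis unfolding eq by simp
    next
      case False
      \<comment> \<open>Now p & q <= q & q < u, so (b) is applied to p & q in place of u: p & q = (p
        & q) & q <= u & q.\<close>
      have v: "T p q \<le> T q q" using T_mono[of p q q q] that by simp
      have vm: "T p q \<in> {0..1}" using T_mem that(1,2) by blast
      have "T (T p q) q = T p q" using b vm v that(2) unfolding cond_b_def by blast
      moreover have "T (T p q) q \<le> T u q"
        using T_mono[OF vm that(3,2,2)] v False by simp
      ultimately show ?thesis unfolding eq by simp
    qed
  qed
  show "cond_a T"
    unfolding cond_a_def
  proof (intro ballI)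
    fix p q u :: real assume pqu: "p \<in> {0..1}" "q \<in> {0..1}" "u \<in> {0..1}"
    have "min (T p q) u \<le> max (T (min p u) q) (T p (min q u))"
    proof (cases "p \<le> q")
      case True
      then show ?thesis using le pqu by blast
    next
      case False
      then have "min (T q p) u \<le> max (T (min q u) p) (T q (min p u))" using le pqu by simp
      moreover have m: "min q u \<in> {0..1}" "min p u \<in> {0..1}" using pqu by auto
      ultimately show ?thesis
        unfolding T_commute[OF pqu(2,1)] T_commute[OF m(1) pqu(1)] T_commute[OF pqu(2) m(2)]
        by linarith
    qed
    then show "min (T p q) u = max (T (min p u) q) (T p (min q u))"
      using cond_a_upper[OF pqu] by simp
  qed
qed

text \<open>If u and p share an interval, then p & p is its left end, so u <= p & p leaves only u
  equal to that end, which is also u & p. Otherwise u & p is the minimum, and u <= p.\<close>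

lemma cond_c_imp_cond_b:
  assumes "cond_c T"
  shows "cond_b T"
proof -
  obtain I :: "nat set" and a b where
    T_eq: "\<forall>p\<in>{0..1}. \<forall>q\<in>{0..1}.
           (\<forall>i\<in>I. p \<in> {a i..b i} \<and> q \<in> {a i..b i} \<longrightarrow> T p q = a i) \<and>
           (\<not> (\<exists>i\<in>I. p \<in> {a i..b i} \<and> q \<in> {a i..b i}) \<longrightarrow> T p q = min p q)"
    using assms unfolding cond_c_def by (elim exE conjE) (rule that; assumption)
  have in_eq: "T p q = a i"
    if "p \<in> {0..1}" "q \<in> {0..1}" "i \<in> I" "p \<in> {a i..b i}" "q \<in> {a i..b i}" for p q i
    using T_eq[rule_format, OF that(1,2), THEN conjunct1] that(3-5) by blast
  have out_eq: "T p q = min p q"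
    if "p \<in> {0..1}" "q \<in> {0..1}" "\<not> (\<exists>i\<in>I. p \<in> {a i..b i} \<and> q \<in> {a i..b i})" for p q
    using T_eq[rule_format, OF that(1,2), THEN conjunct2] that(3) by blast
  show ?thesis
    unfolding cond_b_def
  proof (intro ballI impI)
    fix p u :: real assume pu: "p \<in> {0..1}" "u \<in> {0..1}" "u \<le> T p p"
    have up: "u \<le> p" using pu T_le_left[of p p] by simp
    show "T u p = u"
    proof (cases "\<exists>i\<in>I. u \<in> {a i..b i} \<and> p \<in> {a i..b i}")
      case True
      then obtain i where i: "i \<in> I" "u \<in> {a i..b i}" "p \<in> {a i..b i}" by blast
      have "T p p = a i" "T u p = a i" using in_eq[OF _ _ i(1)] pu(1,2) i(2,3) by blast+
      then show ?thesis using i pu by simp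
    next
      case False
      then show ?thesis using out_eq[of u p] pu(1,2) up by simp
    qed
  qed
qed

text \<open>\<open>E c\<close> is the fibre of p \<mapsto> p & p over \<open>c\<close>, and
  \<open>D\<close> holds the values with a nondegenerate fibre. A fibre containing its value is
  \<open>{c..top c}\<close>, and & is constant on it, since p & q lies between p & p and q & q. If p
  <= q lie in different fibres, then p <= q & q, and (b) gives p & q = p.\<close>

lemma cond_b_imp_cond_c:
  assumes b: "cond_b T"
  shows "cond_c T"
proof -
  define E where "E c = {p \<in> {0..1}. T p p = c}" for c
  define D where "D = {c \<in> {0..<1}. T c c = c \<and> (\<exists>p. p \<noteq> c \<and> p \<in> E c)}"
  define top where "top c = Sup (E c)" for c
  \<comment> \<open>By (b) with u = p & p, multiplying p & p by p changes nothing; doing so twice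
    gives the square of p & p.\<close>
  have sq_idem: "T (T p p) (T p p) = T p p" if p: "p \<in> {0..1}" for p
  proof -
    have m: "T p p \<in> {0..1}" using T_mem p by blast
    then have "T (T p p) p = T p p" using b p unfolding cond_b_def by blast
    then show ?thesis using T_assoc[OF m p p] by simp
  qed
  have sq_mono: "T p p \<le> T q q" if "p \<in> {0..1}" "q \<in> {0..1}" "p \<le> q" for p q
    using T_mono that by blast
  have E_lower: "c \<le> p" if "p \<in> E c" for p c
    using that T_le_left[of p p] by (auto simp: E_def)
  have bdd: "bdd_above (E c)" for c
    by (rule bdd_aboveI[of _ 1]) (auto simp: E_def)
  have E_le_top: "p \<le> top c" if "p \<in> E c" for p c
    unfolding top_def using cSup_upper[OF that bdd] .
  have E_interval: "q \<in> E c" if "p \<in> E c" "p' \<in> E c" "p \<le> q" "q \<le> p'" for p q p' c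
    using that sq_mono[of p q] sq_mono[of q p'] by (auto simp: E_def)
  have top_mem: "top c \<in> E c" if c: "c \<in> E c" for c
  proof -
    have ne: "E c \<noteq> {}" using c by blast
    have c01: "c \<in> {0..1}" using c by (auto simp: E_def)
    have sub: "E c \<subseteq> {0..1}" by (auto simp: E_def)
    have t01: "top c \<in> {0..1}"
      using E_le_top[OF c] c01 cSup_least[OF ne, of 1] sub unfolding top_def by force
    have s: "sup01 (E c) = top c"
      unfolding sup01_def top_def using ne bdd t01[unfolded top_def] by (simp add: cSup_insert sup_max)
    \<comment> \<open>\<open>sup01\<close> inserts the default value 0, which respects the bound
      because 0 <= c.\<close>
    have below: "sup01 S \<le> c" if "\<And>x. x \<in> S \<Longrightarrow> x \<le> c" for S
      unfolding sup01_def using that c01 by (intro cSup_least) auto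
    \<comment> \<open>Left continuity enters twice: the bound p & q <= c on the fibre is passed to
      the supremum in q here, and afterwards to the supremum in p.\<close>
    have "T p (top c) \<le> c" if p: "p \<in> E c" for p
    proof -
      have p01: "p \<in> {0..1}" using p sub by blast
      have "T p q \<le> c" if q: "q \<in> E c" for q
      proof -
        have "max p q \<in> E c" using p q by (simp add: max_def)
        moreover have "T p q \<le> T (max p q) (max p q)" using T_mono p q sub by (auto simp: E_def)
        ultimately show ?thesis by (auto simp: E_def)
      qed
      then have "sup01 (T p ` E c) \<le> c" by (intro below) blast
      then show ?thesis using T_Sup[OF p01 sub] unfolding s by simp
    qed
    then have "T (top c) p \<le> c" if "p \<in> E c" for p
      using that T_commute[of "top c" p] t01 sub by auto
    then have "sup01 (T (top c) ` E c) \<le> c" by (intro below) blast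
    then have "T (top c) (top c) \<le> c" using T_Sup[OF t01 sub] unfolding s by simp
    moreover have "c \<le> T (top c) (top c)"
      using sq_mono[OF c01 t01 E_le_top[OF c]] c by (simp add: E_def)
    ultimately show ?thesis using t01 by (auto simp: E_def)
  qed
  have E_eq: "E c = {c..top c}" if "c \<in> E c" for c
  proof (intro set_eqI iffI)
    fix p assume "p \<in> E c"
    then show "p \<in> {c..top c}" using E_lower[of p c] E_le_top[of p c] by simp
  next
    fix p assume "p \<in> {c..top c}"
    then show "p \<in> E c" using E_interval[OF that top_mem[OF that]] by simp
  qed
  have D: "c \<in> E c" "c < top c" "top c < 1" "0 \<le> c" if cD: "c \<in> D" for c
  proof -
    show c: "c \<in> E c" "0 \<le> c" using that by (auto simp: D_def E_def)
    obtain p where p: "p \<noteq> c" "p \<in> E c" using cD unfolding D_def by blast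
    show "c < top c" using p(1) E_lower[OF p(2)] E_le_top[OF p(2)] by simp
    have t: "top c \<in> {0..1}" "T (top c) (top c) = c" using top_mem[OF c(1)] by (simp_all add: E_def)
    have "top c \<noteq> 1"
    proof
      assume "top c = 1"
      then have "c = 1" using t(2) T_one_right[of 1] by simp
      then show False using that by (simp add: D_def)
    qed
    then show "top c < 1" using t(1) by simp
  qed
  \<comment> \<open>Countability: distinct fibres are disjoint, so a rational chosen inside each
    interval identifies it, and coding the rational gives an index in \<open>nat\<close>.\<close>
  have "\<exists>q. c < of_rat q \<and> of_rat q < top c" if "c \<in> D" for c
    using of_rat_dense[OF D(2)[OF that]] by blast
  then obtain rat_of where rat_of: "\<And>c. c \<in> D \<Longrightarrow> c < of_rat (rat_of c) \<and> of_rat (rat_of c) < top c"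
    by metis
  define code :: "real \<Rightarrow> nat" where "code c = to_nat (rat_of c)" for c
  have inj: "inj_on code D"
  proof (rule inj_onI)
    fix c c' assume c: "c \<in> D" "c' \<in> D" and "code c = code c'"
    then have "rat_of c = rat_of c'" by (simp add: code_def)
    then have "real_of_rat (rat_of c) \<in> E c" "real_of_rat (rat_of c) \<in> E c'"
      unfolding E_eq[OF D(1)[OF c(1)]] E_eq[OF D(1)[OF c(2)]]
      using rat_of[OF c(1)] rat_of[OF c(2)] by simp_all
    then show "c = c'" by (auto simp: E_def)
  qed
  define dec where "dec = inv_into D code"
  have dec: "dec (code c) = c" if "c \<in> D" for c
    unfolding dec_def by (rule inv_into_f_f[OF inj that])
  have in_iff: "p \<in> {c..top c} \<longleftrightarrow> T p p = c" if "c \<in> D" "p \<in> {0..1}" for p c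
    unfolding E_eq[OF D(1)[OF that(1)], symmetric] using that(2) by (simp add: E_def)
  have T_block: "T p q = c" if "p \<in> {0..1}" "q \<in> {0..1}" "T p p = c" "T q q = c" for p q c
  proof (cases "p \<le> q")
    case True
    then show ?thesis using T_mono[of p p p q] T_mono[of p q q q] that by simp
  next
    case False
    then show ?thesis using T_mono[of q p q q] T_mono[of p p q p] that by simp
  qed
  have T_min: "T p q = min p q"
    if p: "p \<in> {0..1}" and q: "q \<in> {0..1}" and no: "\<not> (\<exists>c\<in>D. T p p = c \<and> T q q = c)" for p q
  proof -
    have *: "T p q = p"
      if p: "p \<in> {0..1}" and q: "q \<in> {0..1}" and no: "\<not> (\<exists>c\<in>D. T p p = c \<and> T q q = c)" and "p \<le> q"
      for p q
    proof (cases "p \<le> T q q")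
      case True
      then show ?thesis using b p q unfolding cond_b_def by blast
    next
      case False
      have m: "T q q \<in> {0..1}" using T_mem q by blast
      \<comment> \<open>Squaring q & q < p and using idempotence puts p and q into one fibre. Its
        value is not in \<open>D\<close>, so the fibre is a single point, which contradicts q & q <
        p.\<close>
      have "T q q \<le> T p p" using sq_mono[OF m p] False sq_idem[OF q] by simp
      then have eq: "T p p = T q q" using sq_mono[OF p q \<open>p \<le> q\<close>] by simp
      have "T q q \<notin> D" using no eq by blast
      moreover have "q \<in> E (T q q)" "p \<in> E (T q q)" using p q eq by (auto simp: E_def)
      moreover have "T q q < 1" using False p by auto
      ultimately have "p = T q q" using m sq_idem[OF q] by (auto simp: D_def)
      then show ?thesis using False by simp
    qed
    show ?thesis
    proof (cases "p \<le> q")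
      case True
      then show ?thesis using *[OF p q no] by simp
    next
      case False
      moreover have "\<not> (\<exists>c\<in>D. T q q = c \<and> T p p = c)" using no by blast
      ultimately have "T q p = q" using *[OF q p] by simp
      then show ?thesis using False T_commute[OF p q] by simp
    qed
  qed
  show ?thesis
    unfolding cond_c_def
  proof (intro exI conjI ballI impI)
    fix i assume "i \<in> code ` D"
    then have i: "dec i \<in> D" using dec by auto
    show "0 \<le> dec i" "dec i \<le> top (dec i)" "top (dec i) < 1" using D[OF i] by simp_all
  next
    show "disjoint_family_on (\<lambda>i. {dec i..top (dec i)}) (code ` D)"
      unfolding disjoint_family_on_def
    proof (intro ballI impI)
      fix i j assume "i \<in> code ` D" "j \<in> code ` D" "i \<noteq> j"
      then have ij: "dec i \<in> D" "dec j \<in> D" "dec i \<noteq> dec j" using dec by auto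
      show "{dec i..top (dec i)} \<inter> {dec j..top (dec j)} = {}"
        unfolding E_eq[OF D(1)[OF ij(1)], symmetric] E_eq[OF D(1)[OF ij(2)], symmetric]
        using ij(3) by (auto simp: E_def)
    qed
  next
    fix p q :: real and i
    assume p: "p \<in> {0..1}" and q: "q \<in> {0..1}" and "i \<in> code ` D"
      and *: "p \<in> {dec i..top (dec i)} \<and> q \<in> {dec i..top (dec i)}"
    then have i: "dec i \<in> D" using dec by auto
    have "T p p = dec i" using in_iff[OF i p] * by simp
    moreover have "T q q = dec i" using in_iff[OF i q] * by simp
    ultimately show "T p q = dec i" by (rule T_block[OF p q])
  next
    fix p q :: real
    assume p: "p \<in> {0..1}" and q: "q \<in> {0..1}"
      and no: "\<not> (\<exists>i\<in>code ` D. p \<in> {dec i..top (dec i)} \<and> q \<in> {dec i..top (dec i)})"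
    show "T p q = min p q"
    proof (rule T_min[OF p q], rule notI, elim bexE conjE)
      fix c assume c: "c \<in> D" "T p p = c" "T q q = c"
      then have "p \<in> {c..top c} \<and> q \<in> {c..top c}"
        using in_iff[OF c(1) p] in_iff[OF c(1) q] by blast
      then show False using no dec[OF c(1)] c(1) by force
    qed
  qed
qed

end


section \<open>Finite products in a category\<close>

lemma is_product_pairD:
  assumes "is_product C [A, B] P \<pi>"
  shows "P \<in> Obj C" "\<pi> 0 \<in> Hom C P A" "\<pi> 1 \<in> Hom C P B"
    and "\<lbrakk>Z \<in> Obj C; f \<in> Hom C Z A; g \<in> Hom C Z B\<rbrakk> \<Longrightarrow>
      \<exists>!h. h \<in> Hom C Z P \<and> Cmp C Z P A (\<pi> 0) h = f \<and> Cmp C Z P B (\<pi> 1) h = g"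
proof -
  have two: "(\<forall>i<length [A, B]. Q i) \<longleftrightarrow> Q 0 \<and> Q 1" for Q :: "nat \<Rightarrow> bool"
    by (auto simp: less_Suc_eq)
  note prod = assms[unfolded is_product_def two]
  show "P \<in> Obj C" by (rule conjunct1[OF prod])
  show "\<pi> 0 \<in> Hom C P A"
    using conjunct1[OF conjunct1[OF conjunct2[OF prod]]] by simp
  show "\<pi> 1 \<in> Hom C P B"
    using conjunct2[OF conjunct1[OF conjunct2[OF prod]]] by simp
  assume Z: "Z \<in> Obj C" and f: "f \<in> Hom C Z A" and g: "g \<in> Hom C Z B"
  show "\<exists>!h. h \<in> Hom C Z P \<and> Cmp C Z P A (\<pi> 0) h = f \<and> Cmp C Z P B (\<pi> 1) h = g"
    using conjunct2[OF conjunct2[OF prod], rule_format, OF Z, of "\<lambda>i. if i = 0 then f else g"] f g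
    by simp
qed

context
  fixes C :: "('o, 'm) cat" and A P \<pi>
  assumes C: "category C" and A: "A \<in> Obj C"
    and prod: "\<And>B. B \<in> Obj C \<Longrightarrow> is_product C [A, B] (P B) (\<pi> B)"
begin

lemma product_map_ex1:
  assumes B: "B \<in> Obj C" and B': "B' \<in> Obj C" and f: "f \<in> Hom C B B'"
  shows "\<exists>!h. h \<in> Hom C (P B) (P B') \<and>
        Cmp C (P B) (P B') A (\<pi> B' 0) h = \<pi> B 0 \<and>
        Cmp C (P B) (P B') B' (\<pi> B' 1) h = Cmp C (P B) B B' f (\<pi> B 1)"
proof -
  note PB = is_product_pairD[OF prod[OF B]] and PB' = is_product_pairD[OF prod[OF B']]
  show ?thesis
    by (rule PB'(4)[OF PB(1,2) categoryD(2)[OF C PB(1) B B' PB(3) f]])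
qed

lemma product_map:
  assumes "B \<in> Obj C" "B' \<in> Obj C" "f \<in> Hom C B B'"
  shows "product_map C A P \<pi> B B' f \<in> Hom C (P B) (P B')"
    "Cmp C (P B) (P B') A (\<pi> B' 0) (product_map C A P \<pi> B B' f) = \<pi> B 0"
    "Cmp C (P B) (P B') B' (\<pi> B' 1) (product_map C A P \<pi> B B' f) = Cmp C (P B) B B' f (\<pi> B 1)"
  using theI'[OF product_map_ex1[OF assms], folded product_map_def] by - (elim conjE, assumption)+

lemma product_map_eqI:
  assumes "B \<in> Obj C" "B' \<in> Obj C" "f \<in> Hom C B B'" "h \<in> Hom C (P B) (P B')"
    "Cmp C (P B) (P B') A (\<pi> B' 0) h = \<pi> B 0"
    "Cmp C (P B) (P B') B' (\<pi> B' 1) h = Cmp C (P B) B B' f (\<pi> B 1)"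
  shows "product_map C A P \<pi> B B' f = h"
  unfolding product_map_def
  by (rule the1_equality[OF product_map_ex1[OF assms(1-3)]]) (intro conjI assms(4-6))

lemma is_functor_product_map: "is_functor C C P (product_map C A P \<pi>)"
  unfolding is_functor_def
proof (intro conjI ballI)
  fix B assume B: "B \<in> Obj C"
  note PB = is_product_pairD[OF prod[OF B]]
  show "P B \<in> Obj C" by (rule PB(1))
  show "product_map C A P \<pi> B B (Idn C B) = Idn C (P B)"
    by (rule product_map_eqI[OF B B categoryD(1)[OF C B] categoryD(1)[OF C PB(1)]])
      (simp_all only: categoryD(3)[OF C PB(1) A PB(2)] categoryD(3)[OF C PB(1) B PB(3)]
        categoryD(4)[OF C PB(1) B PB(3)])
  fix B' f assume "B' \<in> Obj C" "f \<in> Hom C B B'"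
  then show "product_map C A P \<pi> B B' f \<in> Hom C (P B) (P B')" by (rule product_map(1)[OF B])
next
  fix X Y Z f g
  assume X: "X \<in> Obj C" and Y: "Y \<in> Obj C" and Z: "Z \<in> Obj C"
    and f: "f \<in> Hom C X Y" and g: "g \<in> Hom C Y Z"
  note PX = is_product_pairD[OF prod[OF X]] and PY = is_product_pairD[OF prod[OF Y]]
    and PZ = is_product_pairD[OF prod[OF Z]]
  note mf = product_map[OF X Y f] and mg = product_map[OF Y Z g]
  show "product_map C A P \<pi> X Z (Cmp C X Y Z g f)
    = Cmp C (P X) (P Y) (P Z) (product_map C A P \<pi> Y Z g) (product_map C A P \<pi> X Y f)"
  proof (rule product_map_eqI[OF X Z categoryD(2)[OF C X Y Z f g]
        categoryD(2)[OF C PX(1) PY(1) PZ(1) mf(1) mg(1)]])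
    show "Cmp C (P X) (P Z) A (\<pi> Z 0)
        (Cmp C (P X) (P Y) (P Z) (product_map C A P \<pi> Y Z g) (product_map C A P \<pi> X Y f)) = \<pi> X 0"
      unfolding categoryD(5)[OF C PX(1) PY(1) PZ(1) A mf(1) mg(1) PZ(2), symmetric] mg(2) mf(2) ..
    show "Cmp C (P X) (P Z) Z (\<pi> Z 1)
        (Cmp C (P X) (P Y) (P Z) (product_map C A P \<pi> Y Z g) (product_map C A P \<pi> X Y f))
      = Cmp C (P X) X Z (Cmp C X Y Z g f) (\<pi> X 1)"
      unfolding categoryD(5)[OF C PX(1) PY(1) PZ(1) Z mf(1) mg(1) PZ(3), symmetric] mg(3)
        categoryD(5)[OF C PX(1) PY(1) Y Z mf(1) PY(3) g] mf(3)
        categoryD(5)[OF C PX(1) X Y Z PX(3) f g] ..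
  qed
qed

end


section \<open>Products of enriched categories\<close>

lemma QCat_simps [simp]:
  "Obj (QCat T U) = {A. fst A \<in> U \<and> is_qcat T A}"
  "Hom (QCat T U) = qfunctors"
  "Idn (QCat T U) A = restrict id (fst A)"
  "Cmp (QCat T U) A B D g f = compose (fst A) g f"
  by (simp_all add: QCat_def)

lemma is_qcat_iff:
  "is_qcat T A \<longleftrightarrow> snd A \<in> fst A \<times> fst A \<rightarrow>\<^sub>E {0..1} \<and> (\<forall>x\<in>fst A. snd A (x, x) = 1) \<and>
    (\<forall>x\<in>fst A. \<forall>y\<in>fst A. \<forall>z\<in>fst A. T (snd A (y, z)) (snd A (x, y)) \<le> snd A (x, z))"
  unfolding is_qcat_def by (simp add: case_prod_beta)

lemma qfunctors_iff:
  "f \<in> qfunctors A B \<longleftrightarrow> f \<in> fst A \<rightarrow>\<^sub>E fst B \<and>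
    (\<forall>x\<in>fst A. \<forall>y\<in>fst A. snd A (x, y) \<le> snd B (f x, f y))"
  unfolding qfunctors_def by (simp add: case_prod_beta)

lemma qfunctorsD:
  assumes "f \<in> qfunctors A B"
  shows "x \<in> fst A \<Longrightarrow> f x \<in> fst B" "f \<in> extensional (fst A)"
    "x \<in> fst A \<Longrightarrow> y \<in> fst A \<Longrightarrow> snd A (x, y) \<le> snd B (f x, f y)"
proof -
  note q = assms[unfolded qfunctors_iff]
  show "x \<in> fst A \<Longrightarrow> f x \<in> fst B" by (rule PiE_mem[OF conjunct1[OF q]])
  show "f \<in> extensional (fst A)" using conjunct1[OF q] by (simp add: PiE_def)
  show "x \<in> fst A \<Longrightarrow> y \<in> fst A \<Longrightarrow> snd A (x, y) \<le> snd B (f x, f y)"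
    by (rule conjunct2[OF q, rule_format])
qed

lemma restrict_mem_qfunctors:
  assumes "\<And>x. x \<in> fst A \<Longrightarrow> f x \<in> fst B"
    "\<And>x y. x \<in> fst A \<Longrightarrow> y \<in> fst A \<Longrightarrow> snd A (x, y) \<le> snd B (f x, f y)"
  shows "restrict f (fst A) \<in> qfunctors A B"
  using assms unfolding qfunctors_iff by simp

lemma qfunctors_eqI:
  assumes "f \<in> qfunctors A B" "g \<in> qfunctors A B'" "\<And>x. x \<in> fst A \<Longrightarrow> f x = g x"
  shows "f = g"
  by (rule extensionalityI[OF qfunctorsD(2)[OF assms(1)] qfunctorsD(2)[OF assms(2)] assms(3)])

text \<open>Carries a hom \<open>d\<close> on an arbitrary index set to a carrier inside
  \<open>'u\<close> along the coding \<open>e\<close>. The restriction meets the extensionality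
  demanded of objects.\<close>

definition qobj :: "('i \<Rightarrow> 'u) \<Rightarrow> 'i set \<Rightarrow> ('i \<Rightarrow> 'i \<Rightarrow> real) \<Rightarrow> 'u qcat" where
  "qobj e J d = (e ` J, restrict (\<lambda>(x, y). d (inv_into J e x) (inv_into J e y)) (e ` J \<times> e ` J))"

lemma fst_qobj [simp]: "fst (qobj e J d) = e ` J"
  by (simp add: qobj_def)

lemma snd_qobj: "\<lbrakk>inj_on e J; i \<in> J; j \<in> J\<rbrakk> \<Longrightarrow> snd (qobj e J d) (e i, e j) = d i j"
  by (simp add: qobj_def)

locale qcat_universe = left_cont_tnorm T for T :: "real \<Rightarrow> real \<Rightarrow> real" +
  fixes U :: "'u set set"
  assumes universe: "universe U"
begin

abbreviation "objs \<equiv> {A. fst A \<in> U \<and> is_qcat T A}"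

lemma objsD:
  assumes "A \<in> objs"
  shows "x \<in> fst A \<Longrightarrow> y \<in> fst A \<Longrightarrow> snd A (x, y) \<in> {0..1}"
    "x \<in> fst A \<Longrightarrow> snd A (x, x) = 1"
    "x \<in> fst A \<Longrightarrow> y \<in> fst A \<Longrightarrow> z \<in> fst A \<Longrightarrow> T (snd A (y, z)) (snd A (x, y)) \<le> snd A (x, z)"
proof -
  have "is_qcat T A" using assms by simp
  note q = this[unfolded is_qcat_iff]
  show "x \<in> fst A \<Longrightarrow> y \<in> fst A \<Longrightarrow> snd A (x, y) \<in> {0..1}"
    by (rule PiE_mem[OF conjunct1[OF q]]) simp
  show "x \<in> fst A \<Longrightarrow> snd A (x, x) = 1"
    by (rule conjunct1[OF conjunct2[OF q], rule_format])
  show "x \<in> fst A \<Longrightarrow> y \<in> fst A \<Longrightarrow> z \<in> fst A \<Longrightarrow> T (snd A (y, z)) (snd A (x, y)) \<le> snd A (x, z)"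
    by (rule conjunct2[OF conjunct2[OF q], rule_format])
qed

lemma qobj_mem:
  assumes inj: "inj_on e J" and "e ` J \<in> U"
    and "\<And>i j. i \<in> J \<Longrightarrow> j \<in> J \<Longrightarrow> d i j \<in> {0..1}" "\<And>i. i \<in> J \<Longrightarrow> d i i = 1"
    and "\<And>i j k. \<lbrakk>i \<in> J; j \<in> J; k \<in> J\<rbrakk> \<Longrightarrow> T (d j k) (d i j) \<le> d i k"
  shows "qobj e J d \<in> objs"
proof -
  have "snd (qobj e J d) \<in> e ` J \<times> e ` J \<rightarrow>\<^sub>E {0..1}"
  proof (rule PiE_I)
    fix z assume "z \<in> e ` J \<times> e ` J"
    then obtain i j where "z = (e i, e j)" "i \<in> J" "j \<in> J" by blast
    then show "snd (qobj e J d) z \<in> {0..1}" using assms(3) by (simp only: snd_qobj[OF inj])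
  next
    fix z assume "z \<notin> e ` J \<times> e ` J"
    then show "snd (qobj e J d) z = undefined"
      by (simp add: qobj_def)
  qed
  moreover have "snd (qobj e J d) (x, x) = 1" if x: "x \<in> e ` J" for x
  proof -
    obtain i where i: "i \<in> J" "x = e i" using x by blast
    show ?thesis unfolding i(2) snd_qobj[OF inj i(1) i(1)] by (rule assms(4)[OF i(1)])
  qed
  moreover have "T (snd (qobj e J d) (y, z)) (snd (qobj e J d) (x, y)) \<le> snd (qobj e J d) (x, z)"
    if x: "x \<in> e ` J" and y: "y \<in> e ` J" and z: "z \<in> e ` J" for x y z
  proof -
    obtain i j k where ijk: "i \<in> J" "j \<in> J" "k \<in> J" and xyz: "x = e i" "y = e j" "z = e k"
      using x y z by blast
    show ?thesis
      unfolding xyz snd_qobj[OF inj ijk(1,2)] snd_qobj[OF inj ijk(2,3)] snd_qobj[OF inj ijk(1,3)]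
      by (rule assms(5)[OF ijk])
  qed
  ultimately show ?thesis using assms(2) by (simp add: is_qcat_iff)
qed

lemma category_QCat: "category (QCat T U)"
  unfolding category_def
proof (intro conjI ballI)
  fix X assume "X \<in> Obj (QCat T U)"
  show "Idn (QCat T U) X \<in> Hom (QCat T U) X X"
    by (simp add: qfunctors_iff)
next
  fix X Y Z f g
  assume f: "f \<in> Hom (QCat T U) X Y" and g: "g \<in> Hom (QCat T U) Y Z"
  note f' = qfunctorsD[OF f[unfolded QCat_simps]] and g' = qfunctorsD[OF g[unfolded QCat_simps]]
  show "Cmp (QCat T U) X Y Z g f \<in> Hom (QCat T U) X Z"
    unfolding QCat_simps compose_def
  proof (rule restrict_mem_qfunctors)
    show "g (f x) \<in> fst Z" if "x \<in> fst X" for x by (rule g'(1)[OF f'(1)[OF that]])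
    show "snd X (x, y) \<le> snd Z (g (f x), g (f y))" if "x \<in> fst X" "y \<in> fst X" for x y
      by (rule order_trans[OF f'(3)[OF that] g'(3)[OF f'(1)[OF that(1)] f'(1)[OF that(2)]]])
  qed
next
  fix X Y f
  assume f: "f \<in> Hom (QCat T U) X Y"
  note f' = qfunctorsD[OF f[unfolded QCat_simps]]
  show "Cmp (QCat T U) X X Y f (Idn (QCat T U) X) = f"
    by (rule extensionalityI[OF _ f'(2)]) (simp_all add: compose_def)
  show "Cmp (QCat T U) X Y Y (Idn (QCat T U) Y) f = f"
    by (rule extensionalityI[OF _ f'(2)]) (simp_all add: compose_def f'(1))
next
  fix W X Y Z f g h
  assume f: "f \<in> Hom (QCat T U) W X"
  note f' = qfunctorsD[OF f[unfolded QCat_simps]]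
  show "Cmp (QCat T U) W X Z (Cmp (QCat T U) X Y Z h g) f =
      Cmp (QCat T U) W Y Z h (Cmp (QCat T U) W X Y g f)"
    by (rule extensionalityI[of _ "fst W"]) (simp_all add: compose_def f'(1))
qed

lemma has_finite_products_QCat: "has_finite_products (QCat T U)"
  unfolding has_finite_products_def
proof (intro allI impI)
  fix As :: "'u qcat list"
  assume As': "set As \<subseteq> Obj (QCat T U)"
  define n where "n = length As"
  have As: "As ! i \<in> objs" if "i < n" for i
    by (rule subsetD[OF As'[unfolded QCat_simps] nth_mem]) (use that n_def in simp)
  define J where "J = {xs. length xs = n \<and> (\<forall>i<n. xs ! i \<in> fst (As ! i))}"
  have J: "xs ! i \<in> fst (As ! i)" if "xs \<in> J" "i < n" for xs i
    using that by (simp add: J_def)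
  \<comment> \<open>The inserted 1 is the minimum of the empty family, so that the empty list of
    factors yields the terminal one-point object.\<close>
  define d where "d xs ys = Min (insert 1 ((\<lambda>i. snd (As ! i) (xs ! i, ys ! i)) ` {..<n}))" for xs ys
  have le_d: "u \<le> d xs ys \<longleftrightarrow> u \<le> 1 \<and> (\<forall>i<n. u \<le> snd (As ! i) (xs ! i, ys ! i))" for u xs ys
    unfolding d_def by (subst Min_ge_iff) auto
  have d_le: "d xs ys \<le> 1" "i < n \<Longrightarrow> d xs ys \<le> snd (As ! i) (xs ! i, ys ! i)" for xs ys i
    using le_d[of "d xs ys" xs ys] by simp_all
  have d_mem: "d xs ys \<in> {0..1}" if "xs \<in> J" "ys \<in> J" for xs ys
    using le_d[of 0 xs ys] d_le(1)[of xs ys] objsD(1)[OF As J[OF that(1)] J[OF that(2)]] by simp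
  have "small U J"
    unfolding J_def by (rule small_lists[OF universe]) (use As in simp)
  then obtain e where inj: "inj_on e J" and eU: "e ` J \<in> U"
    unfolding small_def by blast
  define P where "P = qobj e J d"
  have P: "P \<in> objs"
    unfolding P_def
  proof (rule qobj_mem[OF inj eU d_mem])
    show "d xs xs = 1" if "xs \<in> J" for xs
      using le_d[of 1 xs xs] d_le(1)[of xs xs] objsD(2)[OF As J[OF that]] by simp
    show "T (d ys zs) (d xs ys) \<le> d xs zs" if xs: "xs \<in> J" and ys: "ys \<in> J" and zs: "zs \<in> J"
      for xs ys zs
      unfolding le_d
    proof (intro conjI allI impI)
      show "T (d ys zs) (d xs ys) \<le> 1" using T_mem[OF d_mem[OF ys zs] d_mem[OF xs ys]] by simp
      fix i assume i: "i < n"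
      note mem = J[OF xs i] J[OF ys i] J[OF zs i]
      have "T (d ys zs) (d xs ys)
          \<le> T (snd (As ! i) (ys ! i, zs ! i)) (snd (As ! i) (xs ! i, ys ! i))"
        by (rule T_mono[OF d_mem[OF ys zs] objsD(1)[OF As[OF i] mem(2,3)] d_mem[OF xs ys]
              objsD(1)[OF As[OF i] mem(1,2)] d_le(2)[OF i] d_le(2)[OF i]])
      also have "\<dots> \<le> snd (As ! i) (xs ! i, zs ! i)" by (rule objsD(3)[OF As[OF i] mem])
      finally show "T (d ys zs) (d xs ys) \<le> snd (As ! i) (xs ! i, zs ! i)" .
    qed
  qed
  have sndP: "snd P (e xs, e ys) = d xs ys" if "xs \<in> J" "ys \<in> J" for xs ys
    unfolding P_def by (rule snd_qobj[OF inj that])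
  have fstP: "fst P = e ` J" by (simp add: P_def)
  define \<pi> where "\<pi> i = restrict (\<lambda>w. inv_into J e w ! i) (fst P)" for i
  have \<pi>: "\<pi> i (e xs) = xs ! i" if "xs \<in> J" for i xs
    using that inj by (simp add: \<pi>_def fstP)
  have "is_product (QCat T U) As P \<pi>"
    unfolding is_product_def n_def[symmetric]
  proof (intro conjI allI impI ballI)
    show "P \<in> Obj (QCat T U)" using P by simp
  next
    fix i assume i: "i < n"
    show "\<pi> i \<in> Hom (QCat T U) P (As ! i)"
      unfolding QCat_simps \<pi>_def
    proof (rule restrict_mem_qfunctors)
      show "inv_into J e w ! i \<in> fst (As ! i)" if "w \<in> fst P" for w
        using that J[OF _ i] inj by (auto simp: fstP)
      show "snd P (v, w) \<le> snd (As ! i) (inv_into J e v ! i, inv_into J e w ! i)"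
        if v: "v \<in> fst P" and w: "w \<in> fst P" for v w
      proof -
        obtain xs ys where "xs \<in> J" "ys \<in> J" "v = e xs" "w = e ys"
          using v w unfolding fstP by blast
        then show ?thesis using d_le(2)[OF i] inj by (simp add: sndP)
      qed
    qed
  next
    fix Z f assume Z: "Z \<in> Obj (QCat T U)" and f: "\<forall>i<n. f i \<in> Hom (QCat T U) Z (As ! i)"
    have fi: "f i \<in> qfunctors Z (As ! i)" if "i < n" for i using f that by simp
    have Z': "Z \<in> objs" using Z by simp
    define xs where "xs z = map (\<lambda>i. f i z) [0..<n]" for z
    have xs_nth: "xs z ! i = f i z" if "i < n" for z i using that by (simp add: xs_def)
    have xsJ: "xs z \<in> J" if "z \<in> fst Z" for z
      unfolding J_def using qfunctorsD(1)[OF fi that] by (simp add: xs_def)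
    show "\<exists>!h. h \<in> Hom (QCat T U) Z P \<and> (\<forall>i<n. Cmp (QCat T U) Z P (As ! i) (\<pi> i) h = f i)"
    proof (rule ex1I[of _ "restrict (\<lambda>z. e (xs z)) (fst Z)"], intro conjI allI impI)
      show "restrict (\<lambda>z. e (xs z)) (fst Z) \<in> Hom (QCat T U) Z P"
        unfolding QCat_simps
      proof (rule restrict_mem_qfunctors)
        show "e (xs z) \<in> fst P" if "z \<in> fst Z" for z using xsJ[OF that] by (simp add: fstP)
        show "snd Z (z, w) \<le> snd P (e (xs z), e (xs w))" if zw: "z \<in> fst Z" "w \<in> fst Z" for z w
          unfolding sndP[OF xsJ[OF zw(1)] xsJ[OF zw(2)]] le_d
          using objsD(1)[OF Z' zw] qfunctorsD(3)[OF fi zw] by (simp add: xs_nth)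
      qed
      fix i assume i: "i < n"
      show "Cmp (QCat T U) Z P (As ! i) (\<pi> i) (restrict (\<lambda>z. e (xs z)) (fst Z)) = f i"
        unfolding QCat_simps
        by (rule extensionalityI[OF compose_extensional qfunctorsD(2)[OF fi[OF i]]])
          (simp add: compose_eq \<pi>[OF xsJ] xs_nth[OF i])
    next
      fix h assume h: "h \<in> Hom (QCat T U) Z P \<and> (\<forall>i<n. Cmp (QCat T U) Z P (As ! i) (\<pi> i) h = f i)"
      have hq: "h \<in> qfunctors Z P" using h by simp
      have hf: "compose (fst Z) (\<pi> i) h = f i" if "i < n" for i using h that by simp
      show "h = restrict (\<lambda>z. e (xs z)) (fst Z)"
      proof (rule extensionalityI[OF qfunctorsD(2)[OF hq]])
        fix z assume z: "z \<in> fst Z"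
        obtain ys where ys: "ys \<in> J" "h z = e ys"
          using qfunctorsD(1)[OF hq z] unfolding fstP by blast
        have "ys ! i = xs z ! i" if i: "i < n" for i
          using \<pi>[OF ys(1), of i] fun_cong[OF hf[OF i], of z] z ys(2) i
          by (simp add: compose_eq xs_nth)
        then have "ys = xs z"
          using ys(1) xsJ[OF z] by (intro nth_equalityI) (simp_all add: J_def)
        then show "h z = restrict (\<lambda>z. e (xs z)) (fst Z) z" using z ys(2) by simp
      qed simp
    qed
  qed
  then show "\<exists>P \<pi>. is_product (QCat T U) As P \<pi>" by blast
qed

end


section \<open>Exponentials of enriched categories\<close>

context qcat_universe
begin

text \<open>A functor from the product of \<open>A\<close> and \<open>B\<close> to \<open>Y\<close>
  in curried form. The minimum is the hom of the product, so no chosen product object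
  appears.\<close>

definition bifunctor :: "'u qcat \<Rightarrow> 'u qcat \<Rightarrow> 'u qcat \<Rightarrow> ('u \<Rightarrow> 'u \<Rightarrow> 'u) \<Rightarrow> bool" where
  "bifunctor A B Y h \<longleftrightarrow>
     (\<forall>x\<in>fst A. \<forall>y\<in>fst B. h x y \<in> fst Y) \<and>
     (\<forall>x\<in>fst A. \<forall>x'\<in>fst A. \<forall>y\<in>fst B. \<forall>y'\<in>fst B.
        min (snd A (x, x')) (snd B (y, y')) \<le> snd Y (h x y, h x' y'))"

text \<open>The universal arrow from the functor \<open>A \<times> (-)\<close> to \<open>Y\<close>,
  freed from the choice of products: \<open>ev\<close> is evaluation and \<open>k\<close> is the
  transpose of \<open>h\<close>.\<close>

definition exponential :: "'u qcat \<Rightarrow> 'u qcat \<Rightarrow> 'u qcat \<Rightarrow> ('u \<Rightarrow> 'u \<Rightarrow> 'u) \<Rightarrow> bool" where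
  "exponential A Y G ev \<longleftrightarrow>
     G \<in> objs \<and> bifunctor A G Y ev \<and>
     (\<forall>Z\<in>objs. \<forall>h. bifunctor A Z Y h \<longrightarrow>
        (\<exists>!k. k \<in> qfunctors Z G \<and> (\<forall>x\<in>fst A. \<forall>z\<in>fst Z. ev x (k z) = h x z)))"

lemma bifunctorD:
  assumes "bifunctor A B Y h"
  shows "x \<in> fst A \<Longrightarrow> y \<in> fst B \<Longrightarrow> h x y \<in> fst Y"
    "\<lbrakk>x \<in> fst A; x' \<in> fst A; y \<in> fst B; y' \<in> fst B\<rbrakk>
      \<Longrightarrow> min (snd A (x, x')) (snd B (y, y')) \<le> snd Y (h x y, h x' y')"
  using conjunct1[OF assms[unfolded bifunctor_def]] conjunct2[OF assms[unfolded bifunctor_def]]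
  by simp_all

lemma bifunctorI:
  assumes "\<And>x y. \<lbrakk>x \<in> fst A; y \<in> fst B\<rbrakk> \<Longrightarrow> h x y \<in> fst Y"
    "\<And>x x' y y'. \<lbrakk>x \<in> fst A; x' \<in> fst A; y \<in> fst B; y' \<in> fst B\<rbrakk>
      \<Longrightarrow> min (snd A (x, x')) (snd B (y, y')) \<le> snd Y (h x y, h x' y')"
  shows "bifunctor A B Y h"
  unfolding bifunctor_def by (intro conjI ballI assms)

text \<open>Maps out of the one-point object recover the points of \<open>P\<close> as pairs. The
  hom of \<open>P\<close> is at most the minimum because the projections are functors, and at least
  the minimum by comparison with the object \<open>M\<close> below.\<close>

lemma is_product_pointwise:
  assumes A: "A \<in> objs" and B: "B \<in> objs" and prod: "is_product (QCat T U) [A, B] P \<pi>"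
  shows "P \<in> objs"
    and "z \<in> fst P \<Longrightarrow> \<pi> 0 z \<in> fst A" and "z \<in> fst P \<Longrightarrow> \<pi> 1 z \<in> fst B"
    and "\<lbrakk>x \<in> fst A; y \<in> fst B\<rbrakk> \<Longrightarrow> \<exists>z\<in>fst P. \<pi> 0 z = x \<and> \<pi> 1 z = y"
    and "\<lbrakk>z \<in> fst P; w \<in> fst P; \<pi> 0 z = \<pi> 0 w; \<pi> 1 z = \<pi> 1 w\<rbrakk> \<Longrightarrow> z = w"
    and "\<lbrakk>z \<in> fst P; w \<in> fst P\<rbrakk>
      \<Longrightarrow> snd P (z, w) = min (snd A (\<pi> 0 z, \<pi> 0 w)) (snd B (\<pi> 1 z, \<pi> 1 w))"
proof -
  note pr = is_product_pairD[OF prod, unfolded QCat_simps]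
  show P: "P \<in> objs" by (rule pr(1))
  show p0: "\<pi> 0 z \<in> fst A" and p1: "\<pi> 1 z \<in> fst B" if "z \<in> fst P" for z
    using qfunctorsD(1)[OF pr(2) that] qfunctorsD(1)[OF pr(3) that] by auto
  \<comment> \<open>The one-point object, whose only element is \<open>undefined\<close>; functors
    from it into an object correspond to the points of that object.\<close>
  define pt :: "'u qcat" where "pt = qobj (\<lambda>_. undefined) {()} (\<lambda>_ _. 1)"
  have pt: "pt \<in> objs"
    unfolding pt_def
    by (rule qobj_mem) (simp_all add: universe_finite_mem[OF universe] T_one_left)
  have fst_pt: "fst pt = {undefined}" by (simp add: pt_def)
  have snd_pt: "snd pt (undefined, undefined) = 1" using objsD(2)[OF pt] by (simp add: fst_pt)
  have const: "restrict (\<lambda>_. c) (fst pt) \<in> qfunctors pt B" if "B \<in> objs" "c \<in> fst B" for B c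
    by (rule restrict_mem_qfunctors) (use that objsD(2)[OF that] in \<open>simp_all add: fst_pt snd_pt\<close>)
  show surj: "\<exists>z\<in>fst P. \<pi> 0 z = x \<and> \<pi> 1 z = y" if x: "x \<in> fst A" and y: "y \<in> fst B" for x y
  proof -
    obtain h where h: "h \<in> qfunctors pt P"
      "compose (fst pt) (\<pi> 0) h = restrict (\<lambda>_. x) (fst pt)"
      "compose (fst pt) (\<pi> 1) h = restrict (\<lambda>_. y) (fst pt)"
      using ex1_implies_ex[OF pr(4)[OF pt const[OF A x] const[OF B y]]] by (elim exE conjE)
    show ?thesis
      using qfunctorsD(1)[OF h(1), of undefined] fun_cong[OF h(2), of undefined]
        fun_cong[OF h(3), of undefined]
      by (intro bexI[of _ "h undefined"]) (simp_all add: fst_pt compose_eq)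
  qed
  show inj: "z = w"
    if z: "z \<in> fst P" and w: "w \<in> fst P" and eq: "\<pi> 0 z = \<pi> 0 w" "\<pi> 1 z = \<pi> 1 w" for z w
  proof -
    let ?c = "\<lambda>z. restrict (\<lambda>_. z) (fst pt)"
    have "?c z = ?c w"
    proof (rule ex1E[OF pr(4)[OF pt const[OF A p0[OF z]] const[OF B p1[OF z]]]])
      fix h assume "\<forall>h'. h' \<in> qfunctors pt P \<and> compose (fst pt) (\<pi> 0) h' = ?c (\<pi> 0 z) \<and>
          compose (fst pt) (\<pi> 1) h' = ?c (\<pi> 1 z) \<longrightarrow> h' = h"
      note * = this[rule_format, OF conjI, OF _ conjI]
      have "compose (fst pt) (\<pi> i) (?c v) = ?c (\<pi> i v)" for i v
        by (rule ext) (simp add: compose_def)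
      then show "?c z = ?c w"
        using *[OF const[OF P z]] *[OF const[OF P w]] eq by simp
    qed
    from fun_cong[OF this, of undefined] show ?thesis by (simp add: fst_pt)
  qed
  define m where "m z w = min (snd A (\<pi> 0 z, \<pi> 0 w)) (snd B (\<pi> 1 z, \<pi> 1 w))" for z w
  have m_mem: "m z w \<in> {0..1}" if "z \<in> fst P" "w \<in> fst P" for z w
    using objsD(1)[OF A p0[OF that(1)] p0[OF that(2)]] objsD(1)[OF B p1[OF that(1)] p1[OF that(2)]]
    by (simp add: m_def min_le_iff_disj)
  \<comment> \<open>The points of \<open>P\<close> with the expected hom. The projections are
    functors on \<open>M\<close>, so they induce \<open>h : M \<rightarrow> P\<close>, which is the
    identity on points; its functoriality is the missing inequality.\<close>
  define M where "M = qobj (\<lambda>z. z) (fst P) m"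
  have M: "M \<in> objs"
    unfolding M_def
  proof (rule qobj_mem[OF _ _ m_mem])
    show "(\<lambda>z. z) ` fst P \<in> U" using P by simp
    show "m z z = 1" if "z \<in> fst P" for z
      using objsD(2)[OF A p0[OF that]] objsD(2)[OF B p1[OF that]] by (simp add: m_def)
    show "T (m y z) (m x y) \<le> m x z" if x: "x \<in> fst P" and y: "y \<in> fst P" and z: "z \<in> fst P" for x y z
    proof -
      have "T (m y z) (m x y) \<le> T (snd A (\<pi> 0 y, \<pi> 0 z)) (snd A (\<pi> 0 x, \<pi> 0 y))"
        by (rule T_mono[OF m_mem[OF y z] objsD(1)[OF A p0[OF y] p0[OF z]] m_mem[OF x y]
              objsD(1)[OF A p0[OF x] p0[OF y]]]) (simp_all add: m_def)
      also have "\<dots> \<le> snd A (\<pi> 0 x, \<pi> 0 z)" by (rule objsD(3)[OF A p0[OF x] p0[OF y] p0[OF z]])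
      finally have 1: "T (m y z) (m x y) \<le> snd A (\<pi> 0 x, \<pi> 0 z)" .
      have "T (m y z) (m x y) \<le> T (snd B (\<pi> 1 y, \<pi> 1 z)) (snd B (\<pi> 1 x, \<pi> 1 y))"
        by (rule T_mono[OF m_mem[OF y z] objsD(1)[OF B p1[OF y] p1[OF z]] m_mem[OF x y]
              objsD(1)[OF B p1[OF x] p1[OF y]]]) (simp_all add: m_def)
      also have "\<dots> \<le> snd B (\<pi> 1 x, \<pi> 1 z)" by (rule objsD(3)[OF B p1[OF x] p1[OF y] p1[OF z]])
      finally show ?thesis using 1 by (simp add: m_def[of x z])
    qed
  qed simp_all
  have fstM: "fst M = fst P" by (simp add: M_def)
  have sndM: "snd M (z, w) = m z w" if "z \<in> fst P" "w \<in> fst P" for z w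
    unfolding M_def by (rule snd_qobj[of "\<lambda>z. z", OF _ that]) simp
  have f0: "restrict (\<pi> 0) (fst M) \<in> qfunctors M A"
    by (rule restrict_mem_qfunctors) (simp_all add: fstM p0 sndM m_def)
  have f1: "restrict (\<pi> 1) (fst M) \<in> qfunctors M B"
    by (rule restrict_mem_qfunctors) (simp_all only: fstM p1 sndM m_def min.cobounded2)
  obtain h where h: "h \<in> qfunctors M P"
    "compose (fst M) (\<pi> 0) h = restrict (\<pi> 0) (fst M)"
    "compose (fst M) (\<pi> 1) h = restrict (\<pi> 1) (fst M)"
    using ex1_implies_ex[OF pr(4)[OF M f0 f1]] by (elim exE conjE)
  have h_id: "h z = z" if z: "z \<in> fst P" for z
    by (rule inj[OF qfunctorsD(1)[OF h(1)] z])
      (use fun_cong[OF h(2), of z] fun_cong[OF h(3), of z] z in \<open>simp_all add: fstM compose_eq\<close>)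
  show "snd P (z, w) = min (snd A (\<pi> 0 z, \<pi> 0 w)) (snd B (\<pi> 1 z, \<pi> 1 w))"
    if z: "z \<in> fst P" and w: "w \<in> fst P" for z w
  proof (rule antisym)
    show "snd P (z, w) \<le> min (snd A (\<pi> 0 z, \<pi> 0 w)) (snd B (\<pi> 1 z, \<pi> 1 w))"
      using qfunctorsD(3)[OF pr(2) z w] qfunctorsD(3)[OF pr(3) z w] by simp
    show "min (snd A (\<pi> 0 z, \<pi> 0 w)) (snd B (\<pi> 1 z, \<pi> 1 w)) \<le> snd P (z, w)"
      using qfunctorsD(3)[OF h(1), of z w] h_id[OF z] h_id[OF w] sndM[OF z w] z w
      by (simp add: fstM m_def)
  qed
qed

section \<open>Morphisms out of chosen products as curried maps\<close>

context
  fixes A P \<pi>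
  assumes A: "A \<in> objs"
    and prod: "\<And>B. B \<in> objs \<Longrightarrow> is_product (QCat T U) [A, B] (P B) (\<pi> B)"
begin

lemmas product_pointwise = is_product_pointwise[OF A _ prod]

lemma product_map_pointwise:
  assumes B: "B \<in> objs" and B': "B' \<in> objs" and f: "f \<in> qfunctors B B'" and w: "w \<in> fst (P B)"
  shows "product_map (QCat T U) A P \<pi> B B' f w \<in> fst (P B')"
    "\<pi> B' 0 (product_map (QCat T U) A P \<pi> B B' f w) = \<pi> B 0 w"
    "\<pi> B' 1 (product_map (QCat T U) A P \<pi> B B' f w) = f (\<pi> B 1 w)"
proof -
  have A': "A \<in> Obj (QCat T U)" using A by simp
  have prod': "is_product (QCat T U) [A, B] (P B) (\<pi> B)" if "B \<in> Obj (QCat T U)" for B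
    using prod that by simp
  have BB: "B \<in> Obj (QCat T U)" "B' \<in> Obj (QCat T U)" "f \<in> Hom (QCat T U) B B'"
    using B B' f by simp_all
  note pm = product_map[where C = "QCat T U" and A = A and P = P and \<pi> = \<pi>,
      OF category_QCat A' prod' BB, unfolded QCat_simps]
  show "product_map (QCat T U) A P \<pi> B B' f w \<in> fst (P B')"
    by (rule qfunctorsD(1)[OF pm(1) w])
  show "\<pi> B' 0 (product_map (QCat T U) A P \<pi> B B' f w) = \<pi> B 0 w"
    using fun_cong[OF pm(2), of w] w by (simp add: compose_eq)
  show "\<pi> B' 1 (product_map (QCat T U) A P \<pi> B B' f w) = f (\<pi> B 1 w)"
    using fun_cong[OF pm(3), of w] w by (simp add: compose_eq)
qed

text \<open>Links a map \<open>H\<close> on the chosen product with a two-place map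
  \<open>h\<close>. Extensionality lets \<open>h\<close> determine \<open>H\<close>, whereas
  \<open>h\<close> is fixed by \<open>H\<close> only on the carriers.\<close>

definition curried :: "'u qcat \<Rightarrow> ('u \<Rightarrow> 'u) \<Rightarrow> ('u \<Rightarrow> 'u \<Rightarrow> 'u) \<Rightarrow> bool" where
  "curried B H h \<longleftrightarrow> H \<in> extensional (fst (P B)) \<and> (\<forall>w\<in>fst (P B). H w = h (\<pi> B 0 w) (\<pi> B 1 w))"

lemma curriedD:
  assumes "curried B H h"
  shows "H \<in> extensional (fst (P B))" "w \<in> fst (P B) \<Longrightarrow> H w = h (\<pi> B 0 w) (\<pi> B 1 w)"
  using conjunct1[OF assms[unfolded curried_def]] conjunct2[OF assms[unfolded curried_def]]
  by simp_all

lemma ex_uncurried: "\<exists>H. curried B H h"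
  unfolding curried_def
  by (rule exI[of _ "restrict (\<lambda>w. h (\<pi> B 0 w) (\<pi> B 1 w)) (fst (P B))"]) simp

lemma ex_curried:
  assumes B: "B \<in> objs" and H: "H \<in> extensional (fst (P B))"
  shows "\<exists>h. curried B H h"
proof (intro exI)
  let ?z = "\<lambda>x y. THE z. z \<in> fst (P B) \<and> \<pi> B 0 z = x \<and> \<pi> B 1 z = y"
  have "?z (\<pi> B 0 w) (\<pi> B 1 w) = w" if w: "w \<in> fst (P B)" for w
  proof (rule the_equality)
    show "w \<in> fst (P B) \<and> \<pi> B 0 w = \<pi> B 0 w \<and> \<pi> B 1 w = \<pi> B 1 w" using w by simp
    show "z = w" if "z \<in> fst (P B) \<and> \<pi> B 0 z = \<pi> B 0 w \<and> \<pi> B 1 z = \<pi> B 1 w" for z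
      using product_pointwise(5)[OF B B, of z w] that w by simp
  qed
  then show "curried B H (\<lambda>x y. H (?z x y))"
    unfolding curried_def using H by simp
qed

lemma curried_functor_iff:
  assumes B: "B \<in> objs" and cur: "curried B H h"
  shows "H \<in> qfunctors (P B) Y \<longleftrightarrow> bifunctor A B Y h"
proof
  note pp = product_pointwise[OF B B] and H = curriedD(2)[OF cur]
  assume q: "H \<in> qfunctors (P B) Y"
  show "bifunctor A B Y h"
  proof (rule bifunctorI)
    fix x y assume x: "x \<in> fst A" and y: "y \<in> fst B"
    obtain z where z: "z \<in> fst (P B)" "\<pi> B 0 z = x" "\<pi> B 1 z = y" using pp(4)[OF x y] by blast
    show "h x y \<in> fst Y" using qfunctorsD(1)[OF q z(1)] H[OF z(1)] z(2,3) by simp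
    fix x' y' assume x': "x' \<in> fst A" and y': "y' \<in> fst B"
    obtain z' where z': "z' \<in> fst (P B)" "\<pi> B 0 z' = x'" "\<pi> B 1 z' = y'"
      using pp(4)[OF x' y'] by blast
    show "min (snd A (x, x')) (snd B (y, y')) \<le> snd Y (h x y, h x' y')"
      using qfunctorsD(3)[OF q z(1) z'(1)] pp(6)[OF z(1) z'(1)] H[OF z(1)] H[OF z'(1)] z(2,3) z'(2,3)
      by simp
  qed
next
  note pp = product_pointwise[OF B B] and H = curriedD(2)[OF cur]
  assume b: "bifunctor A B Y h"
  have "restrict H (fst (P B)) \<in> qfunctors (P B) Y"
  proof (rule restrict_mem_qfunctors)
    show "H z \<in> fst Y" if z: "z \<in> fst (P B)" for z
      unfolding H[OF z] by (rule bifunctorD(1)[OF b pp(2)[OF z] pp(3)[OF z]])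
    show "snd (P B) (z, w) \<le> snd Y (H z, H w)" if z: "z \<in> fst (P B)" and w: "w \<in> fst (P B)" for z w
      unfolding H[OF z] H[OF w] pp(6)[OF z w]
      by (rule bifunctorD(2)[OF b pp(2)[OF z] pp(2)[OF w] pp(3)[OF z] pp(3)[OF w]])
  qed
  then show "H \<in> qfunctors (P B) Y" using curriedD(1)[OF cur] by (simp add: extensional_restrict)
qed

lemma compose_product_map_iff:
  assumes Z: "Z \<in> objs" and G: "G \<in> objs" and k: "k \<in> qfunctors Z G"
    and e: "curried G e ev" and H: "curried Z H h"
  shows "compose (fst (P Z)) e (product_map (QCat T U) A P \<pi> Z G k) = H \<longleftrightarrow>
    (\<forall>x\<in>fst A. \<forall>z\<in>fst Z. ev x (k z) = h x z)"
proof -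
  note pp = product_pointwise[OF Z Z] and pm = product_map_pointwise[OF Z G k]
  let ?c = "compose (fst (P Z)) e (product_map (QCat T U) A P \<pi> Z G k)"
  have c: "?c w = ev (\<pi> Z 0 w) (k (\<pi> Z 1 w))" if w: "w \<in> fst (P Z)" for w
    using curriedD(2)[OF e pm(1)[OF w]] pm(2,3)[OF w] w by (simp add: compose_eq)
  show ?thesis
  proof
    assume eq: "?c = H"
    show "\<forall>x\<in>fst A. \<forall>z\<in>fst Z. ev x (k z) = h x z"
    proof (intro ballI)
      fix x z assume x: "x \<in> fst A" and z: "z \<in> fst Z"
      obtain w where w: "w \<in> fst (P Z)" "\<pi> Z 0 w = x" "\<pi> Z 1 w = z" using pp(4)[OF x z] by blast
      show "ev x (k z) = h x z"
        using c[OF w(1)] curriedD(2)[OF H w(1)] eq w(2,3) by simp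
    qed
  next
    assume eq: "\<forall>x\<in>fst A. \<forall>z\<in>fst Z. ev x (k z) = h x z"
    show "?c = H"
    proof (rule extensionalityI[OF compose_extensional curriedD(1)[OF H]])
      fix w assume w: "w \<in> fst (P Z)"
      show "?c w = H w"
        unfolding c[OF w] curriedD(2)[OF H w] by (rule eq[rule_format, OF pp(2)[OF w] pp(3)[OF w]])
    qed
  qed
qed

text \<open>Every morphism out of \<open>P Z\<close> has a curried form and every bifunctor comes
  from such a morphism, so the quantifiers over \<open>H\<close> and \<open>h\<close> can be
  exchanged. Several \<open>h\<close> may represent one \<open>H\<close>, but both conditions see
  only values on the carriers.\<close>

lemma universal_arrow_iff_exponential:
  assumes Y: "Y \<in> objs" and e: "curried G e ev"
  shows "universal_arrow (QCat T U) (QCat T U) P (product_map (QCat T U) A P \<pi>) Y G e \<longleftrightarrow>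
    exponential A Y G ev"
proof (cases "G \<in> objs")
  case False
  then show ?thesis unfolding universal_arrow_def exponential_def QCat_simps by blast
next
  case G: True
  have univ: "(\<forall>H\<in>qfunctors (P Z) Y. \<exists>!k. k \<in> qfunctors Z G \<and>
        compose (fst (P Z)) e (product_map (QCat T U) A P \<pi> Z G k) = H) \<longleftrightarrow>
      (\<forall>h. bifunctor A Z Y h \<longrightarrow>
        (\<exists>!k. k \<in> qfunctors Z G \<and> (\<forall>x\<in>fst A. \<forall>z\<in>fst Z. ev x (k z) = h x z)))"
    (is "(\<forall>H\<in>_. ?L H) \<longleftrightarrow> (\<forall>h. _ \<longrightarrow> ?R h)") if Z: "Z \<in> objs" for Z
  proof -
    have LR: "?L H \<longleftrightarrow> ?R h" if H: "curried Z H h" for H h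
    proof -
      have "(\<lambda>k. k \<in> qfunctors Z G \<and>
          compose (fst (P Z)) e (product_map (QCat T U) A P \<pi> Z G k) = H) =
        (\<lambda>k. k \<in> qfunctors Z G \<and> (\<forall>x\<in>fst A. \<forall>z\<in>fst Z. ev x (k z) = h x z))"
        by (intro ext conj_cong refl compose_product_map_iff[OF Z G _ e H])
      then show ?thesis by (rule arg_cong[where f = Ex1])
    qed
    show ?thesis
    proof (intro iffI ballI allI impI)
      fix h assume all: "\<forall>H\<in>qfunctors (P Z) Y. ?L H" and h: "bifunctor A Z Y h"
      obtain H where H: "curried Z H h" using ex_uncurried by blast
      show "?R h"
        using bspec[OF all, of H] curried_functor_iff[OF Z H, of Y] h LR[OF H] by simp
    next
      fix H assume all: "\<forall>h. bifunctor A Z Y h \<longrightarrow> ?R h" and Hq: "H \<in> qfunctors (P Z) Y"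
      obtain h where H: "curried Z H h" using ex_curried[OF Z qfunctorsD(2)[OF Hq]] by blast
      show "?L H"
        using spec[OF all, of h] curried_functor_iff[OF Z H, of Y] Hq LR[OF H] by simp
    qed
  qed
  show ?thesis
    unfolding universal_arrow_def exponential_def QCat_simps curried_functor_iff[OF G e]
    by (intro conj_cong refl ball_cong univ)
qed

lemma has_right_adjoint_iff_exponential:
  "has_right_adjoint (QCat T U) (QCat T U) P (product_map (QCat T U) A P \<pi>) \<longleftrightarrow>
    (\<forall>Y\<in>objs. \<exists>G ev. exponential A Y G ev)"
proof -
  have A': "A \<in> Obj (QCat T U)" using A by simp
  have prod': "is_product (QCat T U) [A, B] (P B) (\<pi> B)" if "B \<in> Obj (QCat T U)" for B
    using prod that by simp
  have "(\<exists>G e. universal_arrow (QCat T U) (QCat T U) P (product_map (QCat T U) A P \<pi>) Y G e) \<longleftrightarrow>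
      (\<exists>G ev. exponential A Y G ev)" (is "?L \<longleftrightarrow> ?R") if Y: "Y \<in> objs" for Y
  proof
    assume ?L
    then obtain G e where
      ua: "universal_arrow (QCat T U) (QCat T U) P (product_map (QCat T U) A P \<pi>) Y G e" by blast
    then have G: "G \<in> objs" and e: "e \<in> qfunctors (P G) Y"
      unfolding universal_arrow_def QCat_simps by blast+
    obtain ev where "curried G e ev" using ex_curried[OF G qfunctorsD(2)[OF e]] by blast
    then show ?R using universal_arrow_iff_exponential[OF Y] ua by blast
  next
    assume ?R
    then obtain G ev where ex: "exponential A Y G ev" by blast
    obtain e where "curried G e ev" using ex_uncurried by blast
    then show ?L using universal_arrow_iff_exponential[OF Y] ex by blast
  qed
  moreover have "has_right_adjoint (QCat T U) (QCat T U) P (product_map (QCat T U) A P \<pi>) \<longleftrightarrow>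
      (\<forall>Y\<in>Obj (QCat T U). \<exists>G e.
        universal_arrow (QCat T U) (QCat T U) P (product_map (QCat T U) A P \<pi>) Y G e)"
    by (intro has_right_adjoint_iff_universal_arrows category_QCat is_functor_product_map A' prod')
  ultimately show ?thesis by simp
qed

end

lemma cartesian_closed_QCat_iff:
  "cartesian_closed (QCat T U) \<longleftrightarrow> (\<forall>A\<in>objs. \<forall>Y\<in>objs. \<exists>G ev. exponential A Y G ev)"
proof -
  have "(\<exists>P \<pi>. (\<forall>B\<in>Obj (QCat T U). is_product (QCat T U) [A, B] (P B) (\<pi> B)) \<and>
      has_right_adjoint (QCat T U) (QCat T U) P (product_map (QCat T U) A P \<pi>)) \<longleftrightarrow>
    (\<forall>Y\<in>objs. \<exists>G ev. exponential A Y G ev)" (is "?L \<longleftrightarrow> ?R") if A: "A \<in> objs" for A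
  proof
    assume ?L
    then obtain P \<pi> where prod: "\<forall>B\<in>objs. is_product (QCat T U) [A, B] (P B) (\<pi> B)"
      and ra: "has_right_adjoint (QCat T U) (QCat T U) P (product_map (QCat T U) A P \<pi>)"
      unfolding QCat_simps by (elim exE conjE)
    show ?R
      using has_right_adjoint_iff_exponential[OF A bspec[OF prod]] ra by simp
  next
    assume R: ?R
    have "\<exists>p. is_product (QCat T U) [A, B] (fst p) (snd p)" if "B \<in> objs" for B
      using has_finite_products_QCat[unfolded has_finite_products_def, rule_format, of "[A, B]"] A that
      by simp
    then obtain F where "\<forall>B\<in>objs. is_product (QCat T U) [A, B] (fst (F B)) (snd (F B))"
      using bchoice[of objs "\<lambda>B p. is_product (QCat T U) [A, B] (fst p) (snd p)"] by blast
    then obtain P \<pi> where prod: "\<forall>B\<in>objs. is_product (QCat T U) [A, B] (P B) (\<pi> B)"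
      by (rule that)
    have "has_right_adjoint (QCat T U) (QCat T U) P (product_map (QCat T U) A P \<pi>)"
      using has_right_adjoint_iff_exponential[OF A bspec[OF prod]] R by simp
    then show ?L using prod unfolding QCat_simps by (intro exI conjI)
  qed
  then show ?thesis
    unfolding cartesian_closed_def using category_QCat has_finite_products_QCat by simp
qed

end


section \<open>Condition (a) and exponentials\<close>

context qcat_universe
begin

section \<open>From (a) to exponentials\<close>

definition exp_dist :: "'u qcat \<Rightarrow> 'u qcat \<Rightarrow> ('u \<Rightarrow> 'u) \<Rightarrow> ('u \<Rightarrow> 'u) \<Rightarrow> real" where
  "exp_dist A Y f g = Sup {u \<in> {0..1}. \<forall>x\<in>fst A. \<forall>y\<in>fst A. min (snd A (x, y)) u \<le> snd Y (f x, g y)}"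

text \<open>For functors \<open>f\<close> and \<open>g\<close>, \<open>exp_dist\<close> is the
  infimum over x and y of the Goedel implication from \<open>snd A (x, y)\<close> to
  \<open>snd Y (f x, g y)\<close>. The equivalence is the adjunction between the minimum and that
  implication; in particular the supremum in the definition is attained.\<close>

lemma exp_dist:
  assumes A: "A \<in> objs" and Y: "Y \<in> objs" and f: "f \<in> qfunctors A Y" and g: "g \<in> qfunctors A Y"
  shows exp_dist_mem: "exp_dist A Y f g \<in> {0..1}"
    and le_exp_dist_iff: "u \<in> {0..1} \<Longrightarrow> u \<le> exp_dist A Y f g \<longleftrightarrow>
      (\<forall>x\<in>fst A. \<forall>y\<in>fst A. min (snd A (x, y)) u \<le> snd Y (f x, g y))"
proof -
  define S where "S = {u \<in> {0..1}. \<forall>x\<in>fst A. \<forall>y\<in>fst A. min (snd A (x, y)) u \<le> snd Y (f x, g y)}"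
  have S: "exp_dist A Y f g = Sup S" by (simp add: exp_dist_def S_def)
  have memS: "u \<in> S \<longleftrightarrow> u \<in> {0..1} \<and> (\<forall>x\<in>fst A. \<forall>y\<in>fst A. min (snd A (x, y)) u \<le> snd Y (f x, g y))" for u
    by (simp add: S_def)
  have nonneg: "0 \<le> snd Y (f x, g y)" if "x \<in> fst A" "y \<in> fst A" for x y
    using objsD(1)[OF Y qfunctorsD(1)[OF f that(1)] qfunctorsD(1)[OF g that(2)]] by simp
  have zero: "0 \<in> S"
    unfolding memS using nonneg by (simp add: min_le_iff_disj)
  have bdd: "bdd_above S" by (rule bdd_aboveI[of _ 1]) (simp add: memS)
  have upper: "u \<le> Sup S" if "u \<in> S" for u by (rule cSup_upper[OF that bdd])
  have "Sup S \<le> 1" using zero by (intro cSup_least) (blast, simp add: memS)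
  then show "exp_dist A Y f g \<in> {0..1}" using upper[OF zero] by (simp add: S)
  show "u \<le> exp_dist A Y f g \<longleftrightarrow>
      (\<forall>x\<in>fst A. \<forall>y\<in>fst A. min (snd A (x, y)) u \<le> snd Y (f x, g y))" if u: "u \<in> {0..1}"
  proof
    assume le: "u \<le> exp_dist A Y f g"
    show "\<forall>x\<in>fst A. \<forall>y\<in>fst A. min (snd A (x, y)) u \<le> snd Y (f x, g y)"
    proof (intro ballI, rule ccontr)
      fix x y assume xy: "x \<in> fst A" "y \<in> fst A" and "\<not> min (snd A (x, y)) u \<le> snd Y (f x, g y)"
      then have less: "snd Y (f x, g y) < snd A (x, y)" "snd Y (f x, g y) < u" by simp_all
      \<comment> \<open>As \<open>snd Y (f x, g y)\<close> is below \<open>snd A (x, y)\<close>, an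
        admissible \<open>v\<close> must itself be at most \<open>snd Y (f x, g y)\<close>. The
        supremum then stays strictly below \<open>u\<close>.\<close>
      have "v \<le> snd Y (f x, g y)" if v: "v \<in> S" for v
      proof -
        have "min (snd A (x, y)) v \<le> snd Y (f x, g y)"
          using conjunct2[OF v[unfolded memS], rule_format, OF xy] .
        then show ?thesis using less(1) by (simp add: min_le_iff_disj)
      qed
      then have "Sup S \<le> snd Y (f x, g y)" using zero by (intro cSup_least) blast+
      then show False using le less(2) by (simp add: S)
    qed
  next
    assume "\<forall>x\<in>fst A. \<forall>y\<in>fst A. min (snd A (x, y)) u \<le> snd Y (f x, g y)"
    then have "u \<in> S" using u by (simp only: memS simp_thms)
    then show "u \<le> exp_dist A Y f g" unfolding S by (rule upper)
  qed
qed

lemma exp_dist_le: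
  assumes A: "A \<in> objs" and Y: "Y \<in> objs" and f: "f \<in> qfunctors A Y" and g: "g \<in> qfunctors A Y"
    and x: "x \<in> fst A" and y: "y \<in> fst A"
  shows "min (snd A (x, y)) (exp_dist A Y f g) \<le> snd Y (f x, g y)"
  using le_exp_dist_iff[OF A Y f g exp_dist_mem[OF A Y f g]] x y by simp

text \<open>From \<open>f x\<close> one reaches \<open>h z\<close> through \<open>g x\<close> or
  through \<open>g z\<close>. The hom r from x to z cuts down the second leg on the first route and
  the first leg on the second, which gives (v \<and> r) & u and v & (u \<and> r). By (a) the larger
  of the two is (v & u) \<and> r.\<close>

lemma exp_dist_trans:
  assumes a: "cond_a T" and A: "A \<in> objs" and Y: "Y \<in> objs"
    and f: "f \<in> qfunctors A Y" and g: "g \<in> qfunctors A Y" and h: "h \<in> qfunctors A Y"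
  shows "T (exp_dist A Y g h) (exp_dist A Y f g) \<le> exp_dist A Y f h"
proof -
  define u v where "u = exp_dist A Y f g" and "v = exp_dist A Y g h"
  have u: "u \<in> {0..1}" and v: "v \<in> {0..1}"
    unfolding u_def v_def using exp_dist_mem[OF A Y] f g h by blast+
  have "min (snd A (x, z)) (T v u) \<le> snd Y (f x, h z)" if x: "x \<in> fst A" and z: "z \<in> fst A" for x z
  proof -
    define r where "r = snd A (x, z)"
    have r: "r \<in> {0..1}" unfolding r_def by (rule objsD(1)[OF A x z])
    have m: "min v r \<in> {0..1}" "min u r \<in> {0..1}" using u v r by (simp_all add: min_le_iff_disj)
    note fx = qfunctorsD(1)[OF f x] and fz = qfunctorsD(1)[OF f z] and gx = qfunctorsD(1)[OF g x]
      and gz = qfunctorsD(1)[OF g z] and hz = qfunctorsD(1)[OF h z]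
    have uv: "u \<le> snd Y (f x, g x)" "v \<le> snd Y (g z, h z)"
      using exp_dist_le[OF A Y f g x x] exp_dist_le[OF A Y g h z z] u v objsD(2)[OF A x]
        objsD(2)[OF A z] by (simp_all add: u_def v_def)
    have ru: "min u r \<le> snd Y (f x, g z)" and rv: "min v r \<le> snd Y (g x, h z)"
      using exp_dist_le[OF A Y f g x z] exp_dist_le[OF A Y g h x z]
      by (simp_all add: u_def v_def r_def min.commute)
    have "min (T v u) r = max (T (min v r) u) (T v (min u r))"
      using a[unfolded cond_a_def, rule_format, OF v u r] .
    also have "\<dots> \<le> snd Y (f x, h z)"
    proof (rule max.boundedI)
      have "T (min v r) u \<le> T (snd Y (g x, h z)) (snd Y (f x, g x))"
        by (rule T_mono[OF m(1) objsD(1)[OF Y gx hz] u objsD(1)[OF Y fx gx] rv uv(1)])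
      also have "\<dots> \<le> snd Y (f x, h z)" by (rule objsD(3)[OF Y fx gx hz])
      finally show "T (min v r) u \<le> snd Y (f x, h z)" .
      have "T v (min u r) \<le> T (snd Y (g z, h z)) (snd Y (f x, g z))"
        by (rule T_mono[OF v objsD(1)[OF Y gz hz] m(2) objsD(1)[OF Y fx gz] uv(2) ru])
      also have "\<dots> \<le> snd Y (f x, h z)" by (rule objsD(3)[OF Y fx gz hz])
      finally show "T v (min u r) \<le> snd Y (f x, h z)" .
    qed
    finally show ?thesis by (simp add: r_def min.commute)
  qed
  then show ?thesis
    unfolding u_def[symmetric] v_def[symmetric]
    using le_exp_dist_iff[OF A Y f h T_mem[OF v u]] by blast
qed

lemma cond_a_imp_exponential:
  assumes a: "cond_a T" and A: "A \<in> objs" and Y: "Y \<in> objs"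
  shows "\<exists>G ev. exponential A Y G ev"
proof -
  let ?J = "qfunctors A Y"
  have "fst A \<in> U" "fst Y \<in> U" using A Y by simp_all
  then have "small U (fst A \<rightarrow>\<^sub>E fst Y)" by (rule small_PiE[OF universe])
  moreover have "(\<lambda>f. f) ` ?J \<subseteq> fst A \<rightarrow>\<^sub>E fst Y"
    by (rule image_subsetI) (simp only: qfunctors_iff)
  ultimately have "small U ?J" by (rule small_of_inj[OF universe _ inj_on_id2])
  then obtain e where inj: "inj_on e ?J" and eU: "e ` ?J \<in> U" unfolding small_def by blast
  define G where "G = qobj e ?J (exp_dist A Y)"
  have G: "G \<in> objs"
    unfolding G_def
  proof (rule qobj_mem[OF inj eU exp_dist_mem[OF A Y]])
    show "exp_dist A Y f f = 1" if f: "f \<in> ?J" for f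
    proof (rule antisym)
      show "exp_dist A Y f f \<le> 1" using exp_dist_mem[OF A Y f f] by simp
      show "1 \<le> exp_dist A Y f f"
        using le_exp_dist_iff[OF A Y f f, of 1] qfunctorsD(3)[OF f] by (simp add: min.coboundedI1)
    qed
  qed (assumption | rule exp_dist_trans[OF a A Y])+
  have fstG: "fst G = e ` ?J" by (simp add: G_def)
  have sndG: "snd G (e f, e g) = exp_dist A Y f g" if "f \<in> ?J" "g \<in> ?J" for f g
    unfolding G_def by (rule snd_qobj[OF inj that])
  define ev where "ev x w = inv_into ?J e w x" for x w
  have ev: "ev x (e f) = f x" if "f \<in> ?J" for x f
    using inv_into_f_f[OF inj that] by (simp add: ev_def)
  have "bifunctor A G Y ev"
  proof (rule bifunctorI)
    fix x w assume x: "x \<in> fst A" and w: "w \<in> fst G"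
    obtain f where f: "f \<in> ?J" "w = e f" using w unfolding fstG by blast
    show "ev x w \<in> fst Y" unfolding f(2) ev[OF f(1)] by (rule qfunctorsD(1)[OF f(1) x])
    fix x' w' assume x': "x' \<in> fst A" and w': "w' \<in> fst G"
    obtain g where g: "g \<in> ?J" "w' = e g" using w' unfolding fstG by blast
    show "min (snd A (x, x')) (snd G (w, w')) \<le> snd Y (ev x w, ev x' w')"
      unfolding f(2) g(2) ev[OF f(1)] ev[OF g(1)] sndG[OF f(1) g(1)]
      by (rule exp_dist_le[OF A Y f(1) g(1) x x'])
  qed
  moreover have "\<exists>!k. k \<in> qfunctors Z G \<and> (\<forall>x\<in>fst A. \<forall>z\<in>fst Z. ev x (k z) = h x z)"
    if Z: "Z \<in> objs" and h: "bifunctor A Z Y h" for Z h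
  proof -
    define c where "c z = restrict (\<lambda>x. h x z) (fst A)" for z
    have c: "c z \<in> ?J" if z: "z \<in> fst Z" for z
      unfolding c_def
    proof (rule restrict_mem_qfunctors)
      show "h x z \<in> fst Y" if "x \<in> fst A" for x by (rule bifunctorD(1)[OF h that z])
      \<comment> \<open>The reflexivity value 1 of \<open>Z\<close> at z reduces the minimum in the
        bifunctor inequality to the hom of \<open>A\<close>.\<close>
      show "snd A (x, y) \<le> snd Y (h x z, h y z)" if xy: "x \<in> fst A" "y \<in> fst A" for x y
        using bifunctorD(2)[OF h xy z z] objsD(2)[OF Z z] objsD(1)[OF A xy] by simp
    qed
    define k where "k = restrict (\<lambda>z. e (c z)) (fst Z)"
    show ?thesis
    proof (rule ex1I[of _ k], intro conjI ballI)
      show "k \<in> qfunctors Z G"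
        unfolding k_def
      proof (rule restrict_mem_qfunctors)
        show "e (c z) \<in> fst G" if "z \<in> fst Z" for z unfolding fstG by (rule imageI[OF c[OF that]])
        \<comment> \<open>Here the maximality of \<open>exp_dist\<close> matters: the claim becomes
          exactly the bifunctor inequality for \<open>h\<close>.\<close>
        show "snd Z (z, w) \<le> snd G (e (c z), e (c w))" if z: "z \<in> fst Z" and w: "w \<in> fst Z" for z w
          unfolding sndG[OF c[OF z] c[OF w]] le_exp_dist_iff[OF A Y c[OF z] c[OF w] objsD(1)[OF Z z w]]
        proof (intro ballI)
          fix x y assume "x \<in> fst A" "y \<in> fst A"
          then show "min (snd A (x, y)) (snd Z (z, w)) \<le> snd Y (c z x, c w y)"
            using bifunctorD(2)[OF h _ _ z w, of x y] by (simp add: c_def)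
        qed
      qed
      show "ev x (k z) = h x z" if "x \<in> fst A" "z \<in> fst Z" for x z
        using ev[OF c[OF that(2)], of x] that by (simp add: k_def c_def)
    next
      fix k' assume "k' \<in> qfunctors Z G \<and> (\<forall>x\<in>fst A. \<forall>z\<in>fst Z. ev x (k' z) = h x z)"
      then have k': "k' \<in> qfunctors Z G" and eq: "\<And>x z. x \<in> fst A \<Longrightarrow> z \<in> fst Z \<Longrightarrow> ev x (k' z) = h x z"
        by simp_all
      show "k' = k"
      proof (rule extensionalityI[OF qfunctorsD(2)[OF k']])
        fix z assume z: "z \<in> fst Z"
        obtain f where f: "f \<in> ?J" "k' z = e f" using qfunctorsD(1)[OF k' z] unfolding fstG by blast
        have "f = c z"
          by (rule qfunctors_eqI[OF f(1) c[OF z]])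
            (use eq[OF _ z] ev[OF f(1)] f(2) in \<open>simp add: c_def\<close>)
        then show "k' z = k z" using f(2) z by (simp add: k_def)
      qed (simp add: k_def)
    qed
  qed
  ultimately have "exponential A Y G ev"
    unfolding exponential_def by (intro conjI ballI allI impI G)
  then show ?thesis by blast
qed

section \<open>From exponentials to (a)\<close>

definition chain3 :: "real \<Rightarrow> real \<Rightarrow> nat \<Rightarrow> nat \<Rightarrow> real" where
  "chain3 p q i j =
     (if i = j then 1 else if i = 0 \<and> j = 1 then p else if i = 1 \<and> j = 2 then q
      else if i = 0 \<and> j = 2 then T p q else 0)"

lemma chain3_mem: "p \<in> {0..1} \<Longrightarrow> q \<in> {0..1} \<Longrightarrow> chain3 p q i j \<in> {0..1}"
  using T_mem[of p q] by (simp add: chain3_def)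

lemma chain3_refl: "chain3 p q i i = 1"
  by (simp add: chain3_def)

text \<open>Equal indices or a backward step, whose hom is 0, make the inequality immediate. What
  remains is 0 to 1 to 2, where it is an equality because T p q is the least hom from 0 to 2 that
  transitivity permits.\<close>

lemma chain3_trans:
  assumes p: "p \<in> {0..1}" and q: "q \<in> {0..1}" and ijk: "i \<in> {0, 1, 2}" "j \<in> {0, 1, 2}" "k \<in> {0, 1, 2}"
  shows "T (chain3 p q j k) (chain3 p q i j) \<le> chain3 p q i k"
proof -
  note mem = chain3_mem[OF p q]
  consider "i = j" | "j = k" | "i = k" | "j < i" | "k < j" | "i = 0" "j = 1" "k = 2"
    using ijk by fastforce
  then show ?thesis
  proof cases
    case 1
    then show ?thesis using T_one_right[OF mem] by (simp add: chain3_refl)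
  next
    case 2
    then show ?thesis using T_one_left[OF mem] by (simp add: chain3_refl)
  next
    case 3
    then show ?thesis using T_mem[OF mem mem, of j k i j] by (simp add: chain3_refl)
  next
    case 4
    then have "chain3 p q i j = 0" by (simp add: chain3_def)
    then show ?thesis using T_zero_right[OF mem, of j k] mem[of i k] by simp
  next
    case 5
    then have "chain3 p q j k = 0" by (simp add: chain3_def)
    then show ?thesis using T_zero_left[OF mem, of i j] mem[of i k] by simp
  next
    case 6
    then show ?thesis using T_commute[OF p q] by (simp add: chain3_def)
  qed
qed

text \<open>The product of the chain \<open>{0, 1}\<close> with hom \<open>u\<close> and the chain \<open>{0, 1, 2}\<close> glued from the
  two chains with homs \<open>p\<close> and \<open>q\<close>, but with the hom from \<open>(0, 0)\<close> to \<open>(1, 2)\<close> lowered to the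
  value forced by the paths through \<open>(0, 1)\<close> and \<open>(1, 1)\<close>.\<close>

definition glued :: "real \<Rightarrow> real \<Rightarrow> real \<Rightarrow> nat \<times> nat \<Rightarrow> nat \<times> nat \<Rightarrow> real" where
  "glued p q u a b =
     (if a = (0, 0) \<and> b = (1, 2) then max (T (min p u) q) (T p (min q u))
      else min (chain3 u 1 (fst a) (fst b)) (chain3 p q (snd a) (snd b)))"

lemma glued_mem:
  assumes "p \<in> {0..1}" "q \<in> {0..1}" "u \<in> {0..1}"
  shows "glued p q u a b \<in> {0..1}"
proof -
  have "min p u \<in> {0..1}" "min q u \<in> {0..1}" using assms by (simp_all add: min_le_iff_disj)
  then have "T (min p u) q \<in> {0..1}" "T p (min q u) \<in> {0..1}" using T_mem assms by blast+
  moreover have "chain3 u 1 i j \<in> {0..1}" "chain3 p q i j \<in> {0..1}" for i j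
    using chain3_mem assms by simp_all
  ultimately show ?thesis unfolding glued_def by (simp add: le_max_iff_disj min_le_iff_disj)
qed

text \<open>Lowering one hom can break transitivity only where that hom is the bound; elsewhere the
  product bounds apply, since \<open>glued\<close> lies below the product hom by
  \<open>cond_a_upper\<close>. For the lowered pair all six midpoints are checked: (0, 1) and (1, 1)
  give the two terms of the maximum.\<close>

lemma glued_trans:
  assumes p: "p \<in> {0..1}" and q: "q \<in> {0..1}" and u: "u \<in> {0..1}"
    and abc: "a \<in> {0, 1} \<times> {0, 1, 2}" "b \<in> {0, 1} \<times> {0, 1, 2}" "c \<in> {0, 1} \<times> {0, 1, 2}"
  shows "T (glued p q u b c) (glued p q u a b) \<le> glued p q u a c"
proof (cases "a = (0, 0) \<and> c = (1, 2)")
  case False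
  have one: "(1::real) \<in> {0..1}" by simp
  define M where "M a b = min (chain3 u 1 (fst a) (fst b)) (chain3 p q (snd a) (snd b))" for a b
  note gm = glued_mem[OF p q u] and c1 = chain3_mem[OF u one] and c2 = chain3_mem[OF p q]
  have le: "glued p q u a b \<le> M a b" for a b
    using cond_a_upper[OF p q u] by (simp add: glued_def M_def chain3_def)
  have le1: "glued p q u a b \<le> chain3 u 1 (fst a) (fst b)"
    and le2: "glued p q u a b \<le> chain3 p q (snd a) (snd b)" for a b
    using le[of a b] by (simp_all add: M_def)
  have ac: "fst a \<in> {0, 1, 2}" "fst b \<in> {0, 1, 2}" "fst c \<in> {0, 1, 2}"
    "snd a \<in> {0, 1, 2}" "snd b \<in> {0, 1, 2}" "snd c \<in> {0, 1, 2}"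
    using abc unfolding mem_Times_iff by blast+
  have "T (glued p q u b c) (glued p q u a b)
      \<le> T (chain3 u 1 (fst b) (fst c)) (chain3 u 1 (fst a) (fst b))"
    by (rule T_mono[OF gm c1 gm c1 le1 le1])
  also have "\<dots> \<le> chain3 u 1 (fst a) (fst c)" by (rule chain3_trans[OF u one ac(1-3)])
  finally have 1: "T (glued p q u b c) (glued p q u a b) \<le> chain3 u 1 (fst a) (fst c)" .
  have "T (glued p q u b c) (glued p q u a b)
      \<le> T (chain3 p q (snd b) (snd c)) (chain3 p q (snd a) (snd b))"
    by (rule T_mono[OF gm c2 gm c2 le2 le2])
  also have "\<dots> \<le> chain3 p q (snd a) (snd c)" by (rule chain3_trans[OF p q ac(4-6)])
  finally show ?thesis using 1 unfolding glued_def[of p q u a c] if_not_P[OF False] by simp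
next
  case True
  define m where "m = max (T (min p u) q) (T p (min q u))"
  have m: "m \<in> {0..1}"
    using glued_mem[OF p q u, of "(0, 0)" "(1, 2)"] by (simp add: glued_def m_def)
  have pu: "min p u \<in> {0..1}" and qu: "min q u \<in> {0..1}" and pq: "T p q \<in> {0..1}"
    using p q u T_mem by (simp_all add: min_le_iff_disj)
  have m1: "T q (min u p) \<le> m" "T (min u q) p \<le> m"
    using T_commute[OF q pu] T_commute[OF p qu] by (simp_all add: m_def min.commute)
  \<comment> \<open>The midpoints (1, 0) and (0, 2) contribute (p & q) & u and u & (p & q).
    Associativity bounds both by p & (q \<and> u), so they do not raise the lowered value.\<close>
  have "T (T p q) u = T p (T q u)" by (rule T_assoc[OF p q u])
  also have "\<dots> \<le> T p (min q u)"
    using T_mono_right[OF p _ qu, of "T q u"] T_mem[OF q u] T_le_left[OF q u] T_le_right[OF q u] by simp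
  finally have m2: "T (T p q) u \<le> m" by (simp add: m_def)
  then have m3: "T u (T p q) \<le> m" using T_commute[OF pq u] by simp
  have small: "min 1 p = p" "min 1 q = q" "min u 1 = u" "min 1 (T p q) = T p q" "min u (1::real) = u"
    using p q u pq by simp_all
  consider "b = (0, 0)" | "b = (0, 1)" | "b = (0, 2)" | "b = (1, 0)" | "b = (1, 1)" | "b = (1, 2)"
    using abc(2) by auto
  then have "T (glued p q u b (1, 2)) (glued p q u (0, 0) b) \<le> m"
    using m1 m2 m3 T_one_left[OF m] T_one_right[OF m] small
    by cases (simp_all add: glued_def chain3_def m_def[symmetric])
  then show ?thesis using True by (simp add: glued_def m_def)
qed

lemma exponential_imp_cond_a:
  assumes ex: "\<And>A Y. A \<in> objs \<Longrightarrow> Y \<in> objs \<Longrightarrow> \<exists>G ev. exponential A Y G ev"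
  shows "cond_a T"
  unfolding cond_a_def
proof (intro ballI)
  fix p q u :: real assume p: "p \<in> {0..1}" and q: "q \<in> {0..1}" and u: "u \<in> {0..1}"
  have one: "(1::real) \<in> {0..1}" by simp
  \<comment> \<open>\<open>f\<close> places numbers and \<open>e\<close> places pairs of numbers in
    \<open>'u\<close>. Finite carriers belong to every universe, so the test objects also exist in
    the finite case.\<close>
  obtain f :: "nat \<Rightarrow> 'u" where f: "inj f"
    using infinite_countable_subset[OF universe_infinite[OF universe]] by blast
  define e :: "nat \<times> nat \<Rightarrow> 'u" where "e = f \<circ> to_nat"
  have e: "inj e" unfolding e_def by (rule inj_compose[OF f inj_to_nat])
  have finj: "inj_on f S" and einj: "inj_on e S'" for S S'
    by (rule inj_on_subset[OF f subset_UNIV], rule inj_on_subset[OF e subset_UNIV])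
  define C where "C p q S = qobj f S (chain3 p q)" for p q S
  have C: "C p q S \<in> objs" if "p \<in> {0..1}" "q \<in> {0..1}" "S \<subseteq> {0, 1, 2}" for p q S
    unfolding C_def
  proof (rule qobj_mem[OF finj _ chain3_mem[OF that(1,2)] chain3_refl])
    have "finite S" by (rule finite_subset[OF that(3)]) simp
    then show "f ` S \<in> U" by (intro universe_finite_mem[OF universe] finite_imageI)
    show "T (chain3 p q j k) (chain3 p q i j) \<le> chain3 p q i k" if "i \<in> S" "j \<in> S" "k \<in> S" for i j k
      using that \<open>S \<subseteq> {0, 1, 2}\<close> by (intro chain3_trans \<open>p \<in> {0..1}\<close> \<open>q \<in> {0..1}\<close>) blast+
  qed
  have fstC: "fst (C p q S) = f ` S" for p q S by (simp add: C_def)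
  have sndC: "snd (C p q S) (f i, f j) = chain3 p q i j" if "i \<in> S" "j \<in> S" for p q S i j
    unfolding C_def by (rule snd_qobj[OF finj that])
  \<comment> \<open>The two-point chain with hom u from 0 to 1; the 1 stands in for the link from 1
    to 2, which lies outside \<open>{0, 1}\<close>.\<close>
  define A where "A = C u 1 {0, 1}"
  have A: "A \<in> objs" unfolding A_def by (rule C[OF u one]) blast
  define I :: "(nat \<times> nat) set" where "I = {0, 1} \<times> {0, 1, 2}"
  define B where "B = qobj e I (glued p q u)"
  have B: "B \<in> objs"
    unfolding B_def
  proof (rule qobj_mem[OF einj _ glued_mem[OF p q u]])
    show "e ` I \<in> U" by (rule universe_finite_mem[OF universe]) (simp add: I_def)
    show "glued p q u a a = 1" for a by (auto simp: glued_def chain3_def)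
  qed (use glued_trans[OF p q u] in \<open>unfold I_def\<close>)
  have fstB: "fst B = e ` I" by (simp add: B_def)
  have sndB: "snd B (e a, e b) = glued p q u a b" if "a \<in> I" "b \<in> I" for a b
    unfolding B_def by (rule snd_qobj[OF einj that])
  obtain G ev where exp: "exponential A B G ev" using ex[OF A B] by blast
  note exp' = exp[unfolded exponential_def]
  have G: "G \<in> objs" by (rule conjunct1[OF exp'])
  have ev: "bifunctor A G B ev" by (rule conjunct1[OF conjunct2[OF exp']])
  note univ = conjunct2[OF conjunct2[OF exp'], rule_format]
  \<comment> \<open>The identity on index pairs, after decoding by \<open>inv f\<close>.\<close>
  define h where "h x y = e (inv f x, inv f y)" for x y
  have h: "h (f i) (f j) = e (i, j)" for i j by (simp add: h_def inv_f_f[OF f])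
  \<comment> \<open>Excluding 0 and 2 together keeps the lowered pair out of play; on what is left
    \<open>glued\<close> is the product hom.\<close>
  have bif: "bifunctor A (C p q S) B h" if S: "S \<subseteq> {0, 1, 2}" and no: "\<not> (0 \<in> S \<and> 2 \<in> S)" for S
  proof (rule bifunctorI)
    fix x y assume "x \<in> fst A" "y \<in> fst (C p q S)"
    then obtain i j where ij: "x = f i" "i \<in> {0, 1}" "y = f j" "j \<in> S"
      unfolding A_def fstC by blast
    then have I1: "(i, j) \<in> I" using S unfolding I_def by blast
    show "h x y \<in> fst B" unfolding ij(1,3) h fstB by (rule imageI[OF I1])
    fix x' y' assume "x' \<in> fst A" "y' \<in> fst (C p q S)"
    then obtain i' j' where ij': "x' = f i'" "i' \<in> {0, 1}" "y' = f j'" "j' \<in> S"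
      unfolding A_def fstC by blast
    then have I2: "(i', j') \<in> I" using S unfolding I_def by blast
    have "\<not> (j = 0 \<and> j' = 2)" using no ij(4) ij'(4) by blast
    then show "min (snd A (x, x')) (snd (C p q S) (y, y')) \<le> snd B (h x y, h x' y')"
      unfolding ij(1,3) ij'(1,3) h sndB[OF I1 I2] A_def sndC[OF ij(2) ij'(2)] sndC[OF ij(4) ij'(4)]
      by (auto simp: glued_def)
  qed
  have ex_k: "\<exists>k. k \<in> qfunctors (C p q S) G \<and> (\<forall>i\<in>{0, 1}. \<forall>j\<in>S. ev (f i) (k (f j)) = e (i, j))"
    if S: "S \<subseteq> {0, 1, 2}" "\<not> (0 \<in> S \<and> 2 \<in> S)" for S
  proof -
    obtain k where k: "k \<in> qfunctors (C p q S) G"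
      "\<forall>x\<in>fst A. \<forall>z\<in>fst (C p q S). ev x (k z) = h x z"
      using ex1_implies_ex[OF univ[OF C[OF p q S(1)] bif[OF S]]] by (elim exE conjE)
    have "ev (f i) (k (f j)) = e (i, j)" if ij: "i \<in> {0, 1}" "j \<in> S" for i j
    proof -
      have "f i \<in> fst A" "f j \<in> fst (C p q S)"
        unfolding A_def fstC using ij by blast+
      then show ?thesis using k(2) h by simp
    qed
    then show ?thesis using k(1) by blast
  qed
  have S01: "{0, 1} \<subseteq> {0, 1, 2 :: nat}" "\<not> (0 \<in> {0, 1 :: nat} \<and> 2 \<in> {0, 1 :: nat})"
    and S12: "{1, 2} \<subseteq> {0, 1, 2 :: nat}" "\<not> (0 \<in> {1, 2 :: nat} \<and> 2 \<in> {1, 2 :: nat})"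
    by simp_all
  obtain k where k: "k \<in> qfunctors (C p q {0, 1}) G"
    "\<forall>i\<in>{0, 1}. \<forall>j\<in>{0, 1}. ev (f i) (k (f j)) = e (i, j)"
    using ex_k[OF S01] by (elim exE conjE)
  obtain l where l: "l \<in> qfunctors (C p q {1, 2}) G"
    "\<forall>i\<in>{0, 1}. \<forall>j\<in>{1, 2}. ev (f i) (l (f j)) = e (i, j)"
    using ex_k[OF S12] by (elim exE conjE)
  have kG: "k (f 0) \<in> fst G" "k (f 1) \<in> fst G" and lG: "l (f 1) \<in> fst G" "l (f 2) \<in> fst G"
    using qfunctorsD(1)[OF k(1)] qfunctorsD(1)[OF l(1)] by (simp_all add: fstC)
  \<comment> \<open>Both points of \<open>G\<close>, viewed as functors on the one-point object
    \<open>C p q {1}\<close>, transpose the same restriction of \<open>h\<close>, so uniqueness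
    identifies them. This is the gluing.\<close>
  have "k (f 1) = l (f 1)"
  proof -
    let ?D = "C p q {1}"
    have D: "?D \<in> objs" by (rule C[OF p q]) simp
    have sndD: "snd ?D (f 1, f 1) = 1" by (simp add: sndC chain3_refl)
    have c: "restrict (\<lambda>_. g) (f ` {1}) \<in> qfunctors ?D G" if "g \<in> fst G" for g
      using restrict_mem_qfunctors[of ?D "\<lambda>_. g" G] that objsD(2)[OF G that] sndD
      by (simp add: fstC)
    have uni: "\<exists>!k. k \<in> qfunctors ?D G \<and> (\<forall>x\<in>fst A. \<forall>z\<in>fst ?D. ev x (k z) = h x z)"
      by (rule univ[OF D bif]) simp_all
    have sol: "restrict (\<lambda>_. g) (f ` {1}) \<in> qfunctors ?D G \<and>
        (\<forall>x\<in>fst A. \<forall>z\<in>fst ?D. ev x (restrict (\<lambda>_. g) (f ` {1}) z) = h x z)"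
      if "g \<in> fst G" "\<forall>i\<in>{0, 1}. ev (f i) g = e (i, 1)" for g
      using c[OF that(1)] that(2) by (simp add: A_def fstC h)
    have evk: "\<forall>i\<in>{0, 1}. ev (f i) (k (f 1)) = e (i, 1)"
      and evl: "\<forall>i\<in>{0, 1}. ev (f i) (l (f 1)) = e (i, 1)"
      using k(2) l(2) by simp_all
    have "restrict (\<lambda>_. k (f 1)) (f ` {1}) = restrict (\<lambda>_. l (f 1)) (f ` {1})"
      by (rule trans[OF the1_equality[OF uni, symmetric] the1_equality[OF uni]])
        (rule sol[OF kG(2) evk] sol[OF lG(1) evl])+
    from fun_cong[OF this, of "f 1"] show ?thesis by simp
  qed
  then have kl: "snd G (k (f 1), l (f 2)) \<ge> q"
    using qfunctorsD(3)[OF l(1), of "f 1" "f 2"] by (simp add: fstC sndC chain3_def)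
  have kk: "snd G (k (f 0), k (f 1)) \<ge> p"
    using qfunctorsD(3)[OF k(1), of "f 0" "f 1"] by (simp add: fstC sndC chain3_def)
  \<comment> \<open>In the triangle inequality the second leg, with hom at least q, is the left
    factor.\<close>
  have "T p q = T q p" by (rule T_commute[OF p q])
  also have "\<dots> \<le> T (snd G (k (f 1), l (f 2))) (snd G (k (f 0), k (f 1)))"
    by (rule T_mono[OF q objsD(1)[OF G kG(2) lG(2)] p objsD(1)[OF G kG] kl kk])
  also have "\<dots> \<le> snd G (k (f 0), l (f 2))" by (rule objsD(3)[OF G kG lG(2)])
  finally have pq: "T p q \<le> snd G (k (f 0), l (f 2))" .
  have fA: "f 0 \<in> fst A" "f 1 \<in> fst A" by (simp_all add: A_def fstC)
  \<comment> \<open>Evaluating along the hom u of \<open>A\<close> and the hom just found in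
    \<open>G\<close> lands on the corner pair of \<open>B\<close>, whose hom is the right hand side
    of (a).\<close>
  have "min (T p q) u \<le> min (snd A (f 0, f 1)) (snd G (k (f 0), l (f 2)))"
    using pq by (simp add: A_def sndC chain3_def)
  also have "\<dots> \<le> snd B (ev (f 0) (k (f 0)), ev (f 1) (l (f 2)))"
    by (rule bifunctorD(2)[OF ev fA kG(1) lG(2)])
  also have "\<dots> = snd B (e (0, 0), e (1, 2))" using k(2) l(2) by simp
  also have "\<dots> = max (T (min p u) q) (T p (min q u))"
    by (subst sndB) (simp_all add: I_def glued_def)
  finally show "min (T p q) u = max (T (min p u) q) (T p (min q u))"
    using cond_a_upper[OF p q u] by simp
qed

lemma cartesian_closed_QCat_iff_cond_a: "cartesian_closed (QCat T U) \<longleftrightarrow> cond_a T"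
  unfolding cartesian_closed_QCat_iff
proof
  assume ex: "\<forall>A\<in>objs. \<forall>Y\<in>objs. \<exists>G ev. exponential A Y G ev"
  show "cond_a T"
    by (rule exponential_imp_cond_a) (rule ex[THEN bspec, THEN bspec])
next
  assume "cond_a T"
  then show "\<forall>A\<in>objs. \<forall>Y\<in>objs. \<exists>G ev. exponential A Y G ev"
    by (intro ballI cond_a_imp_exponential)
qed

end

theorem theorem3p4:
  fixes T :: "real \<Rightarrow> real \<Rightarrow> real" and U :: "'u set set"
  assumes "left_continuous_tnorm T"
    and "universe U"
  shows "(cartesian_closed (QCat T U) \<longleftrightarrow> cartesian_closed (QCat_fin T U)) \<and>
         (cartesian_closed (QCat_fin T U) \<longleftrightarrow> cond_a T) \<and>
         (cond_a T \<longleftrightarrow> cond_b T) \<and>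
         (cond_b T \<longleftrightarrow> cond_c T)"
proof -
  interpret all: qcat_universe T U
    by unfold_locales (fact assms)+
  interpret fin: qcat_universe T "{X \<in> U. finite X}"
    by unfold_locales (rule universe_finite_members[OF assms(2)])
  show ?thesis
    unfolding QCat_fin_eq all.cartesian_closed_QCat_iff_cond_a fin.cartesian_closed_QCat_iff_cond_a
    using all.cond_a_iff_cond_b all.cond_b_imp_cond_c all.cond_c_imp_cond_b by blast
qed

end
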